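(* Let $\Gamma=F\wr(F\wr\mathbb{Z})$ for a non-trivial finite group $F$. Then $[\Gamma]=0$ in $H_0^f(\Gamma)$, where $f(t)=1+\ln(1+t)$.
   Context: The (restricted) wreath product is $G\wr H=\left(\bigoplus_{h\in H}G\right)\rtimes H$, where $H$ acts on $\bigoplus_{h\in H}G$ by translation of coordinates. The finitely generated group $\Gamma$ carries a word length metric $d$ of a finite symmetric generating set, with base point the identity $e$. For $\overline{x}=(x_0,\dots,x_n)\in\Gamma^{n+1}$ put $|\overline{x}|=\max_id(x_i,e)$, and $d(\overline{x},\overline{y})=\max_id(x_i,y_i)$. For a non-decreasing $f:[0,\infty)\to[0,\infty)$ with $f(0)=1$ such that for every $K>0$ there is $L>0$ with $f(t+K)\le Lf(t)$ and $f(Kt)\le Lf(t)$ for all $t>0$, $C_n^f(\Gamma)$ is the real vector space of functions $c:\Gamma^{n+1}\to\mathbb{R}$ (also written as formal sums of simplices) that are alternating (a permutation of the vertices multiplies the value by its sign), have finite propagation (there is $R$ with $c_{\overline{x}}=0$ whenever $d(\overline{x},\Delta_{n+1})\ge R$, where $\Delta_{n+1}$ is the diagonal), and satisfy $|c_{\overline{x}}|\le K_cf(|\overline{x}|)$ for a constant $K_c$ depending on $c$. The differential is the linear extension of $\partial[x_0,\dots,x_n]=\sum_i(-1)^i[x_0,\dots,\hat{x_i},\dots,x_n]$ (each simplex counted once up to reordering of its vertices); on functions, $(\partial c)(y_0,\dots,y_{n-1})=\sum_{z}c(z,y_0,\dots,y_{n-1})$, in particular $\partial\psi(x)=\sum_y\psi(y,x)$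 for a $1$-chain. $H_*^f(\Gamma)$ is the homology of this complex, and $[\Gamma]\in H_0^f(\Gamma)$ is the class of $\sum_{x\in\Gamma}[x]$. *)

theory Defs
  imports Complex_Main "HOL-Algebra.Algebra" "HOL-Combinatorics.Combinatorics"
begin

section \<open>Restricted wreath products\<close>

definition semidirect_product ::
  "('a, 'm) monoid_scheme \<Rightarrow> ('b, 'n) monoid_scheme \<Rightarrow> ('b \<Rightarrow> 'a \<Rightarrow> 'a) \<Rightarrow> ('a \<times> 'b) monoid"
  where "semidirect_product N H \<alpha> =
    \<lparr>carrier = carrier N \<times> carrier H,
     monoid.mult = (\<lambda>(x, h) (y, k). (x \<otimes>\<^bsub>N\<^esub> \<alpha> h y, h \<otimes>\<^bsub>H\<^esub> k)),
     one = (\<one>\<^bsub>N\<^esub>, \<one>\<^bsub>H\<^esub>)\<rparr>"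

definition translate :: "('b, 'n) monoid_scheme \<Rightarrow> 'b \<Rightarrow> ('b \<Rightarrow> 'a) \<Rightarrow> ('b \<Rightarrow> 'a)"
  where "translate H h \<phi> = (\<lambda>k\<in>carrier H. \<phi> (inv\<^bsub>H\<^esub> h \<otimes>\<^bsub>H\<^esub> k))"

definition wreath_product ::
  "('a, 'm) monoid_scheme \<Rightarrow> ('b, 'n) monoid_scheme \<Rightarrow> (('b \<Rightarrow> 'a) \<times> 'b) monoid"
  where "wreath_product G H =
    semidirect_product (sum_group (carrier H) (\<lambda>_. G)) H (translate H)"

lemma carrier_wreath_product:
  assumes "group G"
  shows "carrier (wreath_product G H) =
    {\<phi> \<in> carrier H \<rightarrow>\<^sub>E carrier G. finite {h \<in> carrier H. \<phi> h \<noteq> \<one>\<^bsub>G\<^esub>}} \<times> carrier H"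
  using assms by (simp add: wreath_product_def semidirect_product_def carrier_sum_group)

lemma one_wreath_product:
  "\<one>\<^bsub>wreath_product G H\<^esub> = (\<lambda>h\<in>carrier H. \<one>\<^bsub>G\<^esub>, \<one>\<^bsub>H\<^esub>)"
  by (simp add: wreath_product_def semidirect_product_def)

lemma mult_wreath_product:
  "(\<phi>, h) \<otimes>\<^bsub>wreath_product G H\<^esub> (\<psi>, k) =
    (\<lambda>x\<in>carrier H. \<phi> x \<otimes>\<^bsub>G\<^esub> \<psi> (inv\<^bsub>H\<^esub> h \<otimes>\<^bsub>H\<^esub> x), h \<otimes>\<^bsub>H\<^esub> k)"
  by (auto simp: wreath_product_def semidirect_product_def translate_def)

lemma group_wreath_product:
  assumes G: "group G" and H: "group H"
  shows "group (wreath_product G H)"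
proof -
  interpret G: group G by (rule G)
  interpret H: group H by (rule H)
  have finite_translate: "finite {x \<in> carrier H. \<psi> (inv\<^bsub>H\<^esub> h \<otimes>\<^bsub>H\<^esub> x) \<noteq> \<one>\<^bsub>G\<^esub>}"
    if "finite {x \<in> carrier H. \<psi> x \<noteq> \<one>\<^bsub>G\<^esub>}" and h: "h \<in> carrier H" for \<psi> h
  proof (rule finite_subset[OF _ finite_imageI[OF that(1), of "\<lambda>x. h \<otimes>\<^bsub>H\<^esub> x"]], rule subsetI)
    fix x assume x: "x \<in> {x \<in> carrier H. \<psi> (inv\<^bsub>H\<^esub> h \<otimes>\<^bsub>H\<^esub> x) \<noteq> \<one>\<^bsub>G\<^esub>}"
    then have "x = h \<otimes>\<^bsub>H\<^esub> (inv\<^bsub>H\<^esub> h \<otimes>\<^bsub>H\<^esub> x)"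
      using h by (simp add: H.m_assoc[symmetric])
    then show "x \<in> (\<lambda>x. h \<otimes>\<^bsub>H\<^esub> x) ` {x \<in> carrier H. \<psi> x \<noteq> \<one>\<^bsub>G\<^esub>}"
      using x h by blast
  qed
  have closed: "p \<otimes>\<^bsub>wreath_product G H\<^esub> q \<in> carrier (wreath_product G H)"
    if p: "p \<in> carrier (wreath_product G H)" and q: "q \<in> carrier (wreath_product G H)" for p q
  proof -
    obtain \<phi> h \<psi> k where [simp]: "p = (\<phi>, h)" "q = (\<psi>, k)"
      by fastforce
    from p q have hk: "h \<in> carrier H" "k \<in> carrier H"
      and \<phi>: "\<phi> \<in> carrier H \<rightarrow>\<^sub>E carrier G" "finite {x \<in> carrier H. \<phi> x \<noteq> \<one>\<^bsub>G\<^esub>}"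
      and \<psi>: "\<psi> \<in> carrier H \<rightarrow>\<^sub>E carrier G" "finite {x \<in> carrier H. \<psi> x \<noteq> \<one>\<^bsub>G\<^esub>}"
      by (auto simp: carrier_wreath_product G)
    have "finite {x \<in> carrier H. \<phi> x \<otimes>\<^bsub>G\<^esub> \<psi> (inv\<^bsub>H\<^esub> h \<otimes>\<^bsub>H\<^esub> x) \<noteq> \<one>\<^bsub>G\<^esub>}"
      by (rule finite_subset[OF _ finite_UnI[OF \<phi>(2) finite_translate[OF \<psi>(2) hk(1)]]]) auto
    then show ?thesis
      using hk \<phi>(1) \<psi>(1)
      by (auto simp: carrier_wreath_product G mult_wreath_product PiE_iff cong: conj_cong)
  qed
  show ?thesis
  proof (rule groupI)
    show "\<one>\<^bsub>wreath_product G H\<^esub> \<in> carrier (wreath_product G H)"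
      by (auto simp: carrier_wreath_product G one_wreath_product)
  next
    fix p q r
    assume "p \<in> carrier (wreath_product G H)" "q \<in> carrier (wreath_product G H)"
      "r \<in> carrier (wreath_product G H)"
    then show "p \<otimes>\<^bsub>wreath_product G H\<^esub> q \<otimes>\<^bsub>wreath_product G H\<^esub> r =
        p \<otimes>\<^bsub>wreath_product G H\<^esub> (q \<otimes>\<^bsub>wreath_product G H\<^esub> r)"
      by (cases p; cases q; cases r)
        (auto simp: carrier_wreath_product G mult_wreath_product PiE_iff H.m_assoc
          H.inv_mult_group intro!: restrict_ext G.m_assoc)
  next
    fix p assume "p \<in> carrier (wreath_product G H)"
    then show "\<one>\<^bsub>wreath_product G H\<^esub> \<otimes>\<^bsub>wreath_product G H\<^esub> p = p"
      by (cases p) (auto simp: carrier_wreath_product G one_wreath_product mult_wreath_product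
          PiE_iff extensional_def)
  next
    fix p assume p: "p \<in> carrier (wreath_product G H)"
    obtain \<phi> h where [simp]: "p = (\<phi>, h)"
      by fastforce
    from p have h: "h \<in> carrier H" and \<phi>: "\<phi> \<in> carrier H \<rightarrow>\<^sub>E carrier G"
        "finite {x \<in> carrier H. \<phi> x \<noteq> \<one>\<^bsub>G\<^esub>}"
      by (auto simp: carrier_wreath_product G)
    let ?q = "(\<lambda>x\<in>carrier H. inv\<^bsub>G\<^esub> \<phi> (h \<otimes>\<^bsub>H\<^esub> x), inv\<^bsub>H\<^esub> h)"
    have "finite {x \<in> carrier H. \<phi> (h \<otimes>\<^bsub>H\<^esub> x) \<noteq> \<one>\<^bsub>G\<^esub>}"
      using finite_translate[OF \<phi>(2), of "inv\<^bsub>H\<^esub> h"] h by simp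
    then have "finite {x \<in> carrier H. inv\<^bsub>G\<^esub> \<phi> (h \<otimes>\<^bsub>H\<^esub> x) \<noteq> \<one>\<^bsub>G\<^esub>}"
      by (rule rev_finite_subset) auto
    then have "?q \<in> carrier (wreath_product G H)"
      using h \<phi>(1) by (auto simp: carrier_wreath_product G PiE_iff cong: conj_cong)
    moreover have "?q \<otimes>\<^bsub>wreath_product G H\<^esub> p = \<one>\<^bsub>wreath_product G H\<^esub>"
      using h \<phi>(1) by (auto simp: mult_wreath_product one_wreath_product PiE_iff
          intro!: restrict_ext G.l_inv)
    ultimately show "\<exists>q\<in>carrier (wreath_product G H).
        q \<otimes>\<^bsub>wreath_product G H\<^esub> p = \<one>\<^bsub>wreath_product G H\<^esub>"
      by blast
  qed (rule closed)
qed


section \<open>Word metrics\<close>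

definition finite_symmetric_generating_set :: "('a, 'm) monoid_scheme \<Rightarrow> 'a set \<Rightarrow> bool"
  where "finite_symmetric_generating_set G S \<longleftrightarrow>
    finite S \<and> S \<subseteq> carrier G \<and> (\<forall>s\<in>S. inv\<^bsub>G\<^esub> s \<in> S) \<and> generate G S = carrier G"

definition word_length :: "('a, 'm) monoid_scheme \<Rightarrow> 'a set \<Rightarrow> 'a \<Rightarrow> nat"
  where "word_length G S g =
    (LEAST n. \<exists>w. length w = n \<and> set w \<subseteq> S \<and> foldr (\<otimes>\<^bsub>G\<^esub>) w \<one>\<^bsub>G\<^esub> = g)"

definition word_dist :: "('a, 'm) monoid_scheme \<Rightarrow> 'a set \<Rightarrow> 'a \<Rightarrow> 'a \<Rightarrow> real"
  where "word_dist G S x y = real (word_length G S (inv\<^bsub>G\<^esub> x \<otimes>\<^bsub>G\<^esub> y))"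


section \<open>The chain complex with controlled growth\<close>

text \<open>A point of \<open>\<Gamma>\<^sup>n\<^sup>+\<^sup>1\<close> is a list of length \<open>n + 1\<close> with entries in the carrier.\<close>

definition tuples :: "('a, 'm) monoid_scheme \<Rightarrow> nat \<Rightarrow> 'a list set"
  where "tuples G n = {xs. length xs = Suc n \<and> set xs \<subseteq> carrier G}"

definition tuple_dist :: "('a, 'm) monoid_scheme \<Rightarrow> 'a set \<Rightarrow> 'a list \<Rightarrow> 'a list \<Rightarrow> real"
  where "tuple_dist G S xs ys = Max ((\<lambda>i. word_dist G S (xs ! i) (ys ! i)) ` {..<length xs})"

definition tuple_norm :: "('a, 'm) monoid_scheme \<Rightarrow> 'a set \<Rightarrow> 'a list \<Rightarrow> real"
  where "tuple_norm G S xs = Max ((\<lambda>x. word_dist G S x \<one>\<^bsub>G\<^esub>) ` set xs)"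

definition diagonal_dist :: "('a, 'm) monoid_scheme \<Rightarrow> 'a set \<Rightarrow> 'a list \<Rightarrow> real"
  where "diagonal_dist G S xs =
    (INF y\<in>carrier G. tuple_dist G S xs (replicate (length xs) y))"

definition growth_function :: "(real \<Rightarrow> real) \<Rightarrow> bool"
  where "growth_function f \<longleftrightarrow>
    (\<forall>t\<ge>0. f t \<ge> 0) \<and> mono_on {0..} f \<and> f 0 = 1 \<and>
    (\<forall>K>0. \<exists>L>0. \<forall>t>0. f (t + K) \<le> L * f t \<and> f (K * t) \<le> L * f t)"

lemma growth_function_log: "growth_function (\<lambda>t. 1 + ln (1 + t))"
  unfolding growth_function_def
proof (intro conjI allI impI)
  show "mono_on {0..} (\<lambda>t. 1 + ln (1 + t :: real))"
    by (auto intro!: mono_onI)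
next
  fix K :: real assume K: "K > 0"
  have bound: "1 + ln (1 + s) \<le> (1 + ln (1 + K)) * (1 + ln (1 + t))"
    if t: "t > 0" and s: "s \<ge> 0" "1 + s \<le> (1 + t) * (1 + K)" for s t
  proof -
    have "ln (1 + s) \<le> ln ((1 + t) * (1 + K))"
      using K t s by (subst ln_le_cancel_iff) auto
    also have "\<dots> = ln (1 + t) + ln (1 + K)"
      using K t by (simp add: ln_mult)
    finally have "ln (1 + s) \<le> ln (1 + t) + ln (1 + K)" .
    moreover have "0 \<le> ln (1 + K) * ln (1 + t)"
      using K t by (intro mult_nonneg_nonneg ln_ge_zero) auto
    ultimately show ?thesis
      by (simp add: algebra_simps)
  qed
  show "\<exists>L>0. \<forall>t>0. 1 + ln (1 + (t + K)) \<le> L * (1 + ln (1 + t)) \<and>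
      1 + ln (1 + K * t) \<le> L * (1 + ln (1 + t))"
  proof (intro exI[of _ "1 + ln (1 + K)"] conjI allI impI bound)
    have "ln (1 + K) \<ge> 0"
      using K by (intro ln_ge_zero) auto
    then show "1 + ln (1 + K) > 0"
      by simp
  qed (use K in \<open>auto simp: algebra_simps\<close>)
qed auto

text \<open>Chains live on the type of all lists; they are required to vanish off \<open>\<Gamma>\<^sup>n\<^sup>+\<^sup>1\<close>, so that
  equality of chains is equality of functions on \<open>\<Gamma>\<^sup>n\<^sup>+\<^sup>1\<close>.\<close>

definition chains ::
  "('a, 'm) monoid_scheme \<Rightarrow> 'a set \<Rightarrow> (real \<Rightarrow> real) \<Rightarrow> nat \<Rightarrow> ('a list \<Rightarrow> real) set"
  where "chains G S f n = {c.
    (\<forall>xs. xs \<notin> tuples G n \<longrightarrow> c xs = 0) \<and>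
    (\<forall>xs\<in>tuples G n. \<forall>\<pi>. \<pi> permutes {..n} \<longrightarrow>
       c (permute_list \<pi> xs) = of_int (sign \<pi>) * c xs) \<and>
    (\<exists>R. \<forall>xs\<in>tuples G n. diagonal_dist G S xs \<ge> R \<longrightarrow> c xs = 0) \<and>
    (\<exists>K. \<forall>xs\<in>tuples G n. \<bar>c xs\<bar> \<le> K * f (tuple_norm G S xs))}"

text \<open>The additive group of the real vector space of chains.\<close>

definition chain_group ::
  "('a, 'm) monoid_scheme \<Rightarrow> 'a set \<Rightarrow> (real \<Rightarrow> real) \<Rightarrow> nat \<Rightarrow> ('a list \<Rightarrow> real) monoid"
  where "chain_group G S f n =
    \<lparr>carrier = chains G S f n, monoid.mult = (\<lambda>c c' xs. c xs + c' xs), one = (\<lambda>_. 0)\<rparr>"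

text \<open>The sum is over the \<open>z\<close> with non-zero contribution; for chains these are finitely many, by
  finite propagation. The value at the empty tuple is set to 0: the complex is not augmented, so the
  differential vanishes on 0-chains.\<close>

definition differential :: "('a, 'm) monoid_scheme \<Rightarrow> ('a list \<Rightarrow> real) \<Rightarrow> 'a list \<Rightarrow> real"
  where "differential G c ys =
    (if ys = [] then 0 else \<Sum>z | z \<in> carrier G \<and> c (z # ys) \<noteq> 0. c (z # ys))"

definition cycle_group ::
  "('a, 'm) monoid_scheme \<Rightarrow> 'a set \<Rightarrow> (real \<Rightarrow> real) \<Rightarrow> nat \<Rightarrow> ('a list \<Rightarrow> real) monoid"
  where "cycle_group G S f n =
    (chain_group G S f n)\<lparr>carrier := {c \<in> chains G S f n. differential G c = (\<lambda>_. 0)}\<rparr>"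

definition boundaries ::
  "('a, 'm) monoid_scheme \<Rightarrow> 'a set \<Rightarrow> (real \<Rightarrow> real) \<Rightarrow> nat \<Rightarrow> ('a list \<Rightarrow> real) set"
  where "boundaries G S f n = differential G ` chains G S f (Suc n)"

definition growth_homology_group ::
  "('a, 'm) monoid_scheme \<Rightarrow> 'a set \<Rightarrow> (real \<Rightarrow> real) \<Rightarrow> nat \<Rightarrow> ('a list \<Rightarrow> real) set monoid"
  where "growth_homology_group G S f n = cycle_group G S f n Mod boundaries G S f n"

definition homology_class ::
  "('a, 'm) monoid_scheme \<Rightarrow> 'a set \<Rightarrow> (real \<Rightarrow> real) \<Rightarrow> nat \<Rightarrow> ('a list \<Rightarrow> real) \<Rightarrow>
    ('a list \<Rightarrow> real) set"
  where "homology_class G S f n c = boundaries G S f n #>\<^bsub>cycle_group G S f n\<^esub> c"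

text \<open>The formal sum \<open>\<Sum>x\<in>\<Gamma>. [x]\<close>, i.e. the function with value 1 at every 0-simplex.\<close>

definition fundamental_cycle :: "('a, 'm) monoid_scheme \<Rightarrow> 'a list \<Rightarrow> real"
  where "fundamental_cycle G xs = (if xs \<in> tuples G 0 then 1 else 0)"

lemma fundamental_cycle_in_cycle_group:
  assumes G: "group G" and f: "growth_function f"
  shows "fundamental_cycle G \<in> carrier (cycle_group G S f 0)"
proof -
  interpret group G by (rule G)
  have tuplesE: "\<exists>x\<in>carrier G. xs = [x]" if "xs \<in> tuples G 0" for xs
    using that by (auto simp: tuples_def length_Suc_conv)
  have diagonal: "diagonal_dist G S xs < 1" if xs: "xs \<in> tuples G 0" for xs
  proof -
    obtain x where x: "x \<in> carrier G" "xs = [x]"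
      using tuplesE[OF xs] by blast
    have "diagonal_dist G S xs \<le> tuple_dist G S xs (replicate (length xs) x)"
      unfolding diagonal_dist_def
      by (rule cINF_lower[OF bdd_belowI2[of _ 0] x(1)])
        (auto simp: x tuple_dist_def word_dist_def lessThan_Suc)
    also have "\<dots> = 0"
      by (auto simp: x tuple_dist_def word_dist_def word_length_def lessThan_Suc intro: Least_eq_0)
    finally show ?thesis
      by simp
  qed
  have growth: "f (tuple_norm G S xs) \<ge> 1" if xs: "xs \<in> tuples G 0" for xs
  proof -
    have "tuple_norm G S xs \<ge> 0"
      using tuplesE[OF xs] by (auto simp: tuple_norm_def word_dist_def)
    then have "f 0 \<le> f (tuple_norm G S xs)"
      using f mono_onD[of "{0..}" f 0 "tuple_norm G S xs"] by (simp add: growth_function_def)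
    then show ?thesis
      using f by (simp add: growth_function_def)
  qed
  have "fundamental_cycle G \<in> chains G S f 0"
    unfolding chains_def mem_Collect_eq
  proof (intro conjI)
    show "\<exists>R. \<forall>xs\<in>tuples G 0. diagonal_dist G S xs \<ge> R \<longrightarrow> fundamental_cycle G xs = 0"
      using diagonal by (intro exI[of _ 1]) force
    show "\<exists>K. \<forall>xs\<in>tuples G 0. \<bar>fundamental_cycle G xs\<bar> \<le> K * f (tuple_norm G S xs)"
      using growth by (intro exI[of _ 1]) (auto simp: fundamental_cycle_def)
  qed (auto simp: fundamental_cycle_def atMost_0)
  moreover have "differential G (fundamental_cycle G) = (\<lambda>_. 0)"
    by (auto simp: differential_def fundamental_cycle_def tuples_def fun_eq_iff)
  ultimately show ?thesis
    by (simp add: cycle_group_def)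
qed

definition fundamental_class ::
  "('a, 'm) monoid_scheme \<Rightarrow> 'a set \<Rightarrow> (real \<Rightarrow> real) \<Rightarrow> ('a list \<Rightarrow> real) set"
  where "fundamental_class G S f = homology_class G S f 0 (fundamental_cycle G)"

end

theory Submission
  imports Defs
begin

text \<open>
  A 1-chain \<open>\<psi>\<close> with \<open>\<partial>\<psi> = [\<Gamma>]\<close> is a flow with net outflow 1 at every element, so it suffices to
  route one unit of mass from every element to infinity along edges of logarithmic load. Let \<open>H\<close> be
  the inner wreath product; it contains a free semigroup on two elements. At \<open>(\<phi>, h)\<close> with \<open>k\<close> lamps
  lit, spread the mass along the \<open>2\<^sup>L\<close> positive words of length \<open>L\<close>, where \<open>2\<^sup>L\<close> is about \<open>4(k + 1)\<close>,
  that start at \<open>h\<close> and end at an unlit lamp, and light that lamp. The number of lit lamps grows, so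
  the mass escapes. An element \<open>(\<phi>', h')\<close> receives the average of the masses on a ball of about
  \<open>4(k + 1)\<close> points of the coset of \<open>\<phi>\<close>, and only the at most \<open>k\<close> lit positions there carry more than
  their own unit. Hence the masses stay bounded, and the load is of order \<open>L\<close>, that is of order
  \<open>ln (1 + k)\<close>, while \<open>k\<close> is at most linear in the word length.
\<close>

section \<open>Word length and boundaries\<close>

lemma (in group) foldr_mult_closed: "set w \<subseteq> carrier G \<Longrightarrow> foldr (\<otimes>) w \<one> \<in> carrier G"
  by (induction w) auto

lemma (in group) foldr_mult_append:
  "set v \<subseteq> carrier G \<Longrightarrow> set w \<subseteq> carrier G \<Longrightarrow>
    foldr (\<otimes>) (v @ w) \<one> = foldr (\<otimes>) v \<one> \<otimes> foldr (\<otimes>) w \<one>"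
proof (induction v)
  case (Cons x v)
  then show ?case
    using foldr_mult_closed[of v] foldr_mult_closed[of w] by (simp add: m_assoc)
qed (use foldr_mult_closed[of w] in auto)

lemma (in group) generating_set_words:
  assumes S: "finite_symmetric_generating_set G S" and g: "g \<in> carrier G"
  shows "\<exists>w. set w \<subseteq> S \<and> foldr (\<otimes>) w \<one> = g"
proof -
  have SG: "S \<subseteq> carrier G" and inv: "\<And>s. s \<in> S \<Longrightarrow> inv s \<in> S" and gen: "generate G S = carrier G"
    using S by (auto simp: finite_symmetric_generating_set_def)
  have "g \<in> generate G S"
    using g gen by simp
  then show ?thesis
  proof (induction rule: generate.induct)
    case one
    show ?case by (intro exI[of _ "[]"]) auto
  next
    case (incl h)
    then show ?case using SG by (intro exI[of _ "[h]"]) auto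
  next
    case (inv h)
    then show ?case using SG \<open>\<And>s. s \<in> S \<Longrightarrow> inv s \<in> S\<close> by (intro exI[of _ "[inv h]"]) auto
  next
    case (eng h1 h2)
    then obtain v w where "set v \<subseteq> S" "foldr (\<otimes>) v \<one> = h1" "set w \<subseteq> S" "foldr (\<otimes>) w \<one> = h2"
      by blast
    then show ?case
      using SG foldr_mult_append[of v w] by (intro exI[of _ "v @ w"]) auto
  qed
qed

lemma (in group) word_length_attained:
  assumes S: "finite_symmetric_generating_set G S" and g: "g \<in> carrier G"
  shows "\<exists>w. length w = word_length G S g \<and> set w \<subseteq> S \<and> foldr (\<otimes>) w \<one> = g"
  unfolding word_length_def
  by (rule LeastI_ex) (use generating_set_words[OF S g] in blast)

lemma (in group) finite_word_ball:
  assumes S: "finite_symmetric_generating_set G S"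
  shows "finite {g \<in> carrier G. real (word_length G S g) < R}"
proof -
  let ?W = "{w. set w \<subseteq> S \<and> length w \<le> nat \<lceil>R\<rceil>}"
  have "finite ?W"
    using S by (intro finite_lists_length_le) (simp add: finite_symmetric_generating_set_def)
  moreover have "{g \<in> carrier G. real (word_length G S g) < R} \<subseteq> (\<lambda>w. foldr (\<otimes>) w \<one>) ` ?W"
  proof
    fix g assume g: "g \<in> {g \<in> carrier G. real (word_length G S g) < R}"
    then obtain w where "length w = word_length G S g" "set w \<subseteq> S" "foldr (\<otimes>) w \<one> = g"
      using word_length_attained[OF S] by blast
    with g show "g \<in> (\<lambda>w. foldr (\<otimes>) w \<one>) ` ?W"
      by (intro image_eqI[of _ _ w]) (auto, linarith)
  qed
  ultimately show ?thesis
    by (rule finite_surj)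
qed

text \<open>If \<open>z\<close> and \<open>hd ys\<close> both lie within distance \<open>R\<close>
  of a common point \<open>y\<close>, then \<open>z\<close> is obtained from \<open>hd ys\<close> by
  multiplying with one element of the ball of radius \<open>R\<close> and the inverse of another.
  This makes the sum in \<open>differential\<close> finite for chains of finite propagation.\<close>

lemma (in group) finite_diagonal_neighbours:
  assumes S: "finite_symmetric_generating_set G S"
    and ys: "ys \<noteq> []" "set ys \<subseteq> carrier G"
  shows "finite {z \<in> carrier G. diagonal_dist G S (z # ys) < R}"
proof -
  let ?B = "{g \<in> carrier G. real (word_length G S g) < R}"
  let ?f = "\<lambda>(b, b'). hd ys \<otimes> b \<otimes> inv b'"
  have hd: "hd ys \<in> carrier G"
    using ys by (cases ys) auto
  have "finite (?B \<times> ?B)"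
    using finite_word_ball[OF S] by blast
  moreover have "{z \<in> carrier G. diagonal_dist G S (z # ys) < R} \<subseteq> ?f ` (?B \<times> ?B)"
  proof
    fix z assume "z \<in> {z \<in> carrier G. diagonal_dist G S (z # ys) < R}"
    then have z: "z \<in> carrier G" and "diagonal_dist G S (z # ys) < R"
      by auto
    moreover have "bdd_below ((\<lambda>y. tuple_dist G S (z # ys) (replicate (length (z # ys)) y)) ` carrier G)"
      by (rule bdd_belowI2[of _ 0])
        (simp add: tuple_dist_def word_dist_def lessThan_Suc_eq_insert_0 Max_ge_iff)
    ultimately obtain y where y: "y \<in> carrier G"
      and d: "tuple_dist G S (z # ys) (replicate (length (z # ys)) y) < R"
      unfolding diagonal_dist_def by (subst (asm) cINF_less_iff) auto
    have "word_dist G S ((z # ys) ! i) (replicate (length (z # ys)) y ! i) < R"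
      if "i < length (z # ys)" for i
      using d that unfolding tuple_dist_def by (subst (asm) Max_less_iff) auto
    from this[of 0] this[of 1] have "word_dist G S z y < R" "word_dist G S (hd ys) y < R"
      using ys by (auto simp: hd_conv_nth)
    then have "inv z \<otimes> y \<in> ?B" "inv (hd ys) \<otimes> y \<in> ?B"
      using z y hd by (auto simp: word_dist_def)
    moreover have "z = ?f (inv (hd ys) \<otimes> y, inv z \<otimes> y)"
      using z y hd by (simp add: inv_mult_group m_assoc) (simp add: m_assoc[symmetric])
    ultimately show "z \<in> ?f ` (?B \<times> ?B)"
      by blast
  qed
  ultimately show ?thesis
    by (rule finite_surj)
qed

section \<open>Linear structure of chains and boundaries\<close>

lemma chains_add_scaled:
  assumes c: "c \<in> chains G S f n" and c': "c' \<in> chains G S f n"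
  shows "(\<lambda>xs. c xs + r * c' xs) \<in> chains G S f n"
proof -
  obtain R K R' K' where
    "\<forall>xs\<in>tuples G n. diagonal_dist G S xs \<ge> R \<longrightarrow> c xs = 0"
    "\<forall>xs\<in>tuples G n. \<bar>c xs\<bar> \<le> K * f (tuple_norm G S xs)"
    "\<forall>xs\<in>tuples G n. diagonal_dist G S xs \<ge> R' \<longrightarrow> c' xs = 0"
    "\<forall>xs\<in>tuples G n. \<bar>c' xs\<bar> \<le> K' * f (tuple_norm G S xs)"
    using c c' unfolding chains_def by blast
  note bounds = this
  have growth: "\<bar>c xs + r * c' xs\<bar> \<le> (K + \<bar>r\<bar> * K') * f (tuple_norm G S xs)"
    if "xs \<in> tuples G n" for xs
  proof -
    have "\<bar>c xs + r * c' xs\<bar> \<le> \<bar>c xs\<bar> + \<bar>r\<bar> * \<bar>c' xs\<bar>"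
      by (simp add: abs_mult[symmetric] abs_triangle_ineq)
    also have "\<dots> \<le> K * f (tuple_norm G S xs) + \<bar>r\<bar> * (K' * f (tuple_norm G S xs))"
      using bounds(2,4) that by (intro add_mono mult_left_mono) auto
    finally show ?thesis
      by (simp add: algebra_simps)
  qed
  show ?thesis
    unfolding chains_def mem_Collect_eq
  proof (intro conjI)
    show "\<exists>R. \<forall>xs\<in>tuples G n. diagonal_dist G S xs \<ge> R \<longrightarrow> c xs + r * c' xs = 0"
      using bounds(1,3) by (intro exI[of _ "max R R'"]) auto
    show "\<exists>K. \<forall>xs\<in>tuples G n. \<bar>c xs + r * c' xs\<bar> \<le> K * f (tuple_norm G S xs)"
      using growth by blast
  qed (use c c' in \<open>auto simp: chains_def algebra_simps\<close>)
qed

lemma (in group) finite_chain_support: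
  assumes S: "finite_symmetric_generating_set G S" and c: "c \<in> chains G S f n" and ys: "ys \<noteq> []"
  shows "finite {z \<in> carrier G. c (z # ys) \<noteq> 0}"
proof (cases "set ys \<subseteq> carrier G")
  case True
  obtain R where R: "\<forall>xs\<in>tuples G n. diagonal_dist G S xs \<ge> R \<longrightarrow> c xs = 0"
    and off: "\<forall>xs. xs \<notin> tuples G n \<longrightarrow> c xs = 0"
    using c unfolding chains_def by blast
  have "{z \<in> carrier G. c (z # ys) \<noteq> 0} \<subseteq> {z \<in> carrier G. diagonal_dist G S (z # ys) < R}"
    using R off by force
  then show ?thesis
    by (rule finite_subset) (rule finite_diagonal_neighbours[OF S ys True])
next
  case False
  then have "c (z # ys) = 0" for z
    using c by (auto simp: chains_def tuples_def)
  then show ?thesis by simp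
qed

text \<open>The index set in \<open>differential\<close> is the support, which changes with the
  chain, and a sum over an infinite set is 0 by convention. Linearity therefore rests on finite
  propagation: all three sums may be taken over the finite union \<open>?Z\<close> of the two
  supports.\<close>

lemma (in group) differential_add_scaled:
  assumes S: "finite_symmetric_generating_set G S"
    and c: "c \<in> chains G S f n" and c': "c' \<in> chains G S f n"
  shows "differential G (\<lambda>xs. c xs + r * c' xs) = (\<lambda>ys. differential G c ys + r * differential G c' ys)"
proof
  fix ys
  show "differential G (\<lambda>xs. c xs + r * c' xs) ys = differential G c ys + r * differential G c' ys"
  proof (cases "ys = []")
    case False
    let ?Z = "{z \<in> carrier G. c (z # ys) \<noteq> 0} \<union> {z \<in> carrier G. c' (z # ys) \<noteq> 0}"
    have fin: "finite ?Z"
      using finite_chain_support[OF S c False] finite_chain_support[OF S c' False] by blast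
    have restrict: "differential G b ys = (\<Sum>z\<in>?Z. b (z # ys))"
      if "\<And>z. z \<in> carrier G \<Longrightarrow> b (z # ys) \<noteq> 0 \<Longrightarrow> z \<in> ?Z" for b
      unfolding differential_def using False that
      by (auto intro!: sum.mono_neutral_left fin)
    have
      "differential G c ys = (\<Sum>z\<in>?Z. c (z # ys))"
      "differential G c' ys = (\<Sum>z\<in>?Z. c' (z # ys))"
      "differential G (\<lambda>xs. c xs + r * c' xs) ys = (\<Sum>z\<in>?Z. c (z # ys) + r * c' (z # ys))"
      by (rule restrict; auto)+
    then show ?thesis
      by (simp only: sum.distrib sum_distrib_left)
  qed (simp add: differential_def)
qed

text \<open>The class is the coset of the boundaries through the fundamental cycle, and the
  boundaries are closed under sums and differences. So the coset through a boundary is the set of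
  boundaries itself, which is the unit of the quotient.\<close>

lemma (in group) fundamental_class_eq_one:
  assumes S: "finite_symmetric_generating_set G S"
    and bd: "fundamental_cycle G \<in> boundaries G S f 0"
  shows "fundamental_class G S f = \<one>\<^bsub>growth_homology_group G S f 0\<^esub>"
proof -
  have closed: "(\<lambda>xs. b xs + r * b' xs) \<in> boundaries G S f 0"
    if bb: "b \<in> boundaries G S f 0" "b' \<in> boundaries G S f 0" for b b' r
  proof -
    obtain c c' where c: "c \<in> chains G S f (Suc 0)" "c' \<in> chains G S f (Suc 0)"
      and b: "b = differential G c" "b' = differential G c'"
      using bb unfolding boundaries_def by (elim imageE) auto
    show ?thesis
      unfolding boundaries_def b differential_add_scaled[OF S c, symmetric]
      by (intro imageI chains_add_scaled c)
  qed
  let ?u = "fundamental_cycle G"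
  have "fundamental_class G S f = {\<lambda>xs. b xs + ?u xs | b. b \<in> boundaries G S f 0}"
    by (auto simp: fundamental_class_def homology_class_def r_coset_def cycle_group_def chain_group_def)
  also have "\<dots> = boundaries G S f 0"
  proof (intro equalityI subsetI)
    fix b assume "b \<in> boundaries G S f 0"
    then have "(\<lambda>xs. b xs + (-1) * ?u xs) \<in> boundaries G S f 0"
      by (intro closed bd)
    then show "b \<in> {\<lambda>xs. b xs + ?u xs | b. b \<in> boundaries G S f 0}"
      by (intro CollectI exI[of _ "\<lambda>xs. b xs + (-1) * ?u xs"]) auto
  qed (use closed[OF _ bd, of _ 1] in auto)
  also have "\<dots> = \<one>\<^bsub>growth_homology_group G S f 0\<^esub>"
    by (simp add: growth_homology_group_def FactGroup_def)
  finally show ?thesis .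
qed

section \<open>Flows along finitely many group elements\<close>

lemma permutes_atMost_1:
  assumes "\<pi> permutes {..Suc 0}"
  shows "\<pi> = id \<or> \<pi> = transpose 0 (Suc 0)"
proof -
  have "{..Suc 0} = {0, Suc 0}" by auto
  with assms have "\<pi> permutes {0, Suc 0}" by simp
  then show ?thesis
    by (simp add: permutes_doubleton_iff)
qed

text \<open>Think of \<open>e x q\<close> as the amount transported from \<open>x\<close> to \<open>x \<otimes> q\<close>.\<close>

lemma (in group) fundamental_cycle_boundaryI:
  assumes S: "finite_symmetric_generating_set G S"
    and Q: "finite Q" "Q \<subseteq> carrier G"
    and f: "mono_on {0..} f"
    and growth: "\<And>x q. x \<in> carrier G \<Longrightarrow> q \<in> Q \<Longrightarrow> \<bar>e x q\<bar> \<le> K * f (word_dist G S x \<one>)" and "0 \<le> K"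
    and div: "\<And>x. x \<in> carrier G \<Longrightarrow> (\<Sum>q\<in>Q. e x q) - (\<Sum>q\<in>Q. e (x \<otimes> inv q) q) = 1"
  shows "fundamental_cycle G \<in> boundaries G S f 0"
proof -
  define E where "E x y = (\<Sum>q\<in>Q. if y = x \<otimes> q then e x q else 0)" for x y
  \<comment> \<open>The flow is antisymmetrised to make it alternating. The sign is chosen so that
    \<open>\<psi> [z, x]\<close> is what goes from \<open>x\<close> to \<open>z\<close> minus what
    comes back: since \<open>differential\<close> sums over the first vertex, it then yields outflow
    minus inflow at \<open>x\<close>.\<close>
  define \<psi> where "\<psi> xs = (if xs \<in> tuples G 1 then E (xs ! 1) (xs ! 0) - E (xs ! 0) (xs ! 1) else 0)" for xs
  have tuplesE: "\<exists>x y. xs = [x, y] \<and> x \<in> carrier G \<and> y \<in> carrier G" if "xs \<in> tuples G 1" for xs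
    using that by (auto simp: tuples_def length_Suc_conv)
  have \<psi>: "\<psi> [x, y] = E y x - E x y" if "x \<in> carrier G" "y \<in> carrier G" for x y
    using that by (simp add: \<psi>_def tuples_def)
  have E_nonzero: "\<exists>q\<in>Q. y = x \<otimes> q" if "E x y \<noteq> 0" for x y
  proof (rule ccontr)
    assume "\<not> (\<exists>q\<in>Q. y = x \<otimes> q)"
    then have "E x y = 0"
      unfolding E_def by (intro sum.neutral) auto
    with that show False by simp
  qed
  have E_bound: "\<bar>E x y\<bar> \<le> real (card Q) * K * f (tuple_norm G S xs)"
    if "x \<in> set xs" "x \<in> carrier G" for x y xs
  proof -
    have "0 \<le> word_dist G S x \<one>"
      by (simp add: word_dist_def)
    moreover have "word_dist G S x \<one> \<le> tuple_norm G S xs"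
      unfolding tuple_norm_def using that by (intro Max_ge) auto
    ultimately have f_le: "f (word_dist G S x \<one>) \<le> f (tuple_norm G S xs)"
      using mono_onD[OF f] by fastforce
    have summand: "\<bar>if y = x \<otimes> q then e x q else 0\<bar> \<le> K * f (tuple_norm G S xs)" if q: "q \<in> Q" for q
    proof -
      have "\<bar>e x q\<bar> \<le> K * f (tuple_norm G S xs)"
        using growth[OF \<open>x \<in> carrier G\<close> q] mult_left_mono[OF f_le \<open>0 \<le> K\<close>] by linarith
      then show ?thesis by auto
    qed
    have "\<bar>E x y\<bar> \<le> (\<Sum>q\<in>Q. \<bar>if y = x \<otimes> q then e x q else 0\<bar>)"
      unfolding E_def by (rule sum_abs)
    also have "\<dots> \<le> real (card Q) * (K * f (tuple_norm G S xs))"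
      using summand by (rule sum_bounded_above)
    finally show ?thesis by (simp add: mult.assoc)
  qed
  define R where "R = Max (insert 0 (word_length G S ` (Q \<union> m_inv G ` Q)))"
  have R: "word_length G S q \<le> R" if "q \<in> Q \<union> m_inv G ` Q" for q
    unfolding R_def using Q that by (intro Max_ge) auto
  have \<psi>_chain: "\<psi> \<in> chains G S f 1"
    unfolding chains_def mem_Collect_eq
  proof (intro conjI ballI allI impI)
    fix xs \<pi> assume xs: "xs \<in> tuples G 1" and \<pi>: "\<pi> permutes {..1::nat}"
    obtain x y where xy: "xs = [x, y]" "x \<in> carrier G" "y \<in> carrier G"
      using tuplesE[OF xs] by blast
    from \<pi> have "\<pi> = id \<or> \<pi> = transpose 0 (Suc 0)"
      using permutes_atMost_1 by simp
    then show "\<psi> (permute_list \<pi> xs) = of_int (sign \<pi>) * \<psi> xs"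
      by (auto simp: xy \<psi> permute_list_def sign_swap_id)
  next
    show "\<exists>R. \<forall>xs\<in>tuples G 1. diagonal_dist G S xs \<ge> R \<longrightarrow> \<psi> xs = 0"
    \<comment> \<open>Two points exchanging mass differ by an element of \<open>Q\<close> or an
      inverse of one, hence are at distance at most \<open>R\<close>. This value may be attained and
      the propagation condition is non-strict, which explains the extra 1.\<close>
    proof (intro exI[of _ "real R + 1"] ballI impI, rule ccontr)
      fix xs assume xs: "xs \<in> tuples G 1" and far: "real R + 1 \<le> diagonal_dist G S xs" and "\<psi> xs \<noteq> 0"
      obtain x y where xy: "xs = [x, y]" "x \<in> carrier G" "y \<in> carrier G"
        using tuplesE[OF xs] by blast
      have "E y x \<noteq> 0 \<or> E x y \<noteq> 0"
        using \<open>\<psi> xs \<noteq> 0\<close> by (auto simp: xy \<psi>)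
      then obtain q where q: "q \<in> Q" "x = y \<otimes> q \<or> y = x \<otimes> q"
        using E_nonzero[of x y] E_nonzero[of y x] by blast
      have "q \<in> carrier G"
        using q(1) Q(2) by blast
      from q(2) have "inv x \<otimes> y \<in> {q, inv q}"
      proof
        assume "x = y \<otimes> q"
        then have "inv x \<otimes> y = inv q"
          using \<open>q \<in> carrier G\<close> xy(3) by (simp add: inv_mult_group m_assoc)
        then show ?thesis by simp
      next
        assume "y = x \<otimes> q"
        then have "inv x \<otimes> y = q"
          using \<open>q \<in> carrier G\<close> xy(2) by (simp add: m_assoc[symmetric])
        then show ?thesis by simp
      qed
      then have "inv x \<otimes> y \<in> Q \<union> m_inv G ` Q"
        using q(1) by auto
      then have "word_dist G S x y \<le> real R"
        using R by (simp add: word_dist_def)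
      have bdd: "bdd_below ((\<lambda>z. tuple_dist G S xs (replicate (length xs) z)) ` carrier G)"
        by (rule bdd_belowI2[of _ 0])
          (auto simp: xy tuple_dist_def word_dist_def lessThan_Suc)
      have "diagonal_dist G S xs \<le> tuple_dist G S xs (replicate (length xs) y)"
        unfolding diagonal_dist_def by (rule cINF_lower[OF bdd xy(3)])
      also have "\<dots> = max (word_dist G S x y) (word_dist G S y y)"
        by (simp add: xy tuple_dist_def lessThan_Suc max.commute)
      also have "\<dots> \<le> real R"
      proof -
        have "word_length G S \<one> = 0"
          unfolding word_length_def by (rule Least_eq_0) simp
        then show ?thesis
          using xy \<open>word_dist G S x y \<le> real R\<close> by (simp add: word_dist_def)
      qed
      finally show False using far by simp
    qed
    show "\<exists>K. \<forall>xs\<in>tuples G 1. \<bar>\<psi> xs\<bar> \<le> K * f (tuple_norm G S xs)"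
    proof (intro exI[of _ "2 * real (card Q) * K"] ballI)
      fix xs assume xs: "xs \<in> tuples G 1"
      obtain x y where xy: "xs = [x, y]" "x \<in> carrier G" "y \<in> carrier G"
        using tuplesE[OF xs] by blast
      then show "\<bar>\<psi> xs\<bar> \<le> 2 * real (card Q) * K * f (tuple_norm G S xs)"
        using E_bound[of x xs y] E_bound[of y xs x] by (simp add: \<psi>)
    qed
  qed (auto simp: \<psi>_def)
  have "differential G \<psi> = fundamental_cycle G"
  proof
    fix ys
    show "differential G \<psi> ys = fundamental_cycle G ys"
    proof (cases "ys \<in> tuples G 0")
      case True
      then obtain x where x: "ys = [x]" "x \<in> carrier G"
        by (auto simp: tuples_def length_Suc_conv)
      \<comment> \<open>A finite set holding all targets and all sources of mass at
        \<open>x\<close>, so that the sums over \<open>z\<close> and over \<open>q\<close> can be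
        exchanged.\<close>
      define Z where "Z = (\<lambda>q. x \<otimes> q) ` Q \<union> (\<lambda>q. x \<otimes> inv q) ` Q"
      have Z: "finite Z" "Z \<subseteq> carrier G"
        using Q x by (auto simp: Z_def)
      have backward: "x = z \<otimes> q \<longleftrightarrow> z = x \<otimes> inv q" if "z \<in> carrier G" "q \<in> Q" for z q
        using that Q x by (metis inv_solve_right subsetD)
      have "differential G \<psi> ys = (\<Sum>z | z \<in> carrier G \<and> \<psi> [z, x] \<noteq> 0. \<psi> [z, x])"
        by (simp add: differential_def x)
      also have "\<dots> = (\<Sum>z\<in>Z. \<psi> [z, x])"
      proof (rule sum.mono_neutral_left)
        show "{z \<in> carrier G. \<psi> [z, x] \<noteq> 0} \<subseteq> Z"
        proof
          fix z assume "z \<in> {z \<in> carrier G. \<psi> [z, x] \<noteq> 0}"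
          then have z: "z \<in> carrier G" and "E x z \<noteq> 0 \<or> E z x \<noteq> 0"
            using x by (auto simp: \<psi>)
          then obtain q where q: "q \<in> Q" "z = x \<otimes> q \<or> x = z \<otimes> q"
            using E_nonzero[of x z] E_nonzero[of z x] by blast
          then show "z \<in> Z"
            using backward[OF z q(1)] by (auto simp: Z_def)
        qed
      qed (use Z in auto)
      also have "\<dots> = (\<Sum>z\<in>Z. E x z) - (\<Sum>z\<in>Z. E z x)"
        using Z x by (subst sum_subtractf[symmetric]) (auto intro!: sum.cong simp: \<psi>)
      also have "(\<Sum>z\<in>Z. E x z) = (\<Sum>q\<in>Q. \<Sum>z\<in>Z. if z = x \<otimes> q then e x q else 0)"
        unfolding E_def by (rule sum.swap)
      also have "\<dots> = (\<Sum>q\<in>Q. e x q)"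
        using Z by (intro sum.cong) (auto simp: Z_def)
      also have "(\<Sum>z\<in>Z. E z x) = (\<Sum>q\<in>Q. \<Sum>z\<in>Z. if x = z \<otimes> q then e z q else 0)"
        unfolding E_def by (rule sum.swap)
      also have "\<dots> = (\<Sum>q\<in>Q. \<Sum>z\<in>Z. if z = x \<otimes> inv q then e (x \<otimes> inv q) q else 0)"
        using Z backward by (intro sum.cong) auto
      also have "\<dots> = (\<Sum>q\<in>Q. e (x \<otimes> inv q) q)"
        using Z by (intro sum.cong) (auto simp: Z_def)
      finally show ?thesis
        using div[OF x(2)] True by (simp add: fundamental_cycle_def)
    next
      case False
      then have "\<psi> (z # ys) = 0" for z
        by (auto simp: \<psi>_def tuples_def)
      with False show ?thesis
        by (simp add: differential_def fundamental_cycle_def)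
    qed
  qed
  with \<psi>_chain show ?thesis
    unfolding boundaries_def by (metis One_nat_def imageI)
qed

section \<open>The flow on a wreath product\<close>

text \<open>Freeness enters only through words of equal length, separately for each
  \<open>n\<close>, because all walks offered at one configuration have the same length.\<close>

locale free_semigroup_wreath = F: group F + H: group H
  for F :: "('a, 'm) monoid_scheme" and H :: "('b, 'n) monoid_scheme" +
  fixes a :: 'a and D :: "'b set"
  assumes a: "a \<in> carrier F" "a \<noteq> \<one>\<^bsub>F\<^esub>"
    and D: "D \<subseteq> carrier H" "card D = 2"
    and free: "inj_on (\<lambda>w. foldr (\<otimes>\<^bsub>H\<^esub>) w \<one>\<^bsub>H\<^esub>) {w. set w \<subseteq> D \<and> length w = n}"
begin

abbreviation endpoint :: "'b list \<Rightarrow> 'b"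
  where "endpoint w \<equiv> foldr (\<otimes>\<^bsub>H\<^esub>) w \<one>\<^bsub>H\<^esub>"

definition support :: "('b \<Rightarrow> 'a) \<Rightarrow> 'b set"
  where "support \<phi> = {h \<in> carrier H. \<phi> h \<noteq> \<one>\<^bsub>F\<^esub>}"

text \<open>The lower bound \<open>4 * Suc k\<close> keeps the lit positions below a quarter of the
  endpoints; minimality keeps the walk length logarithmic in \<open>k\<close>.\<close>

definition scale :: "nat \<Rightarrow> nat"
  where "scale k = (LEAST L. 4 * Suc k \<le> 2 ^ L)"

definition walks :: "nat \<Rightarrow> 'b list set"
  where "walks k = {w. set w \<subseteq> D \<and> length w = scale k}"

definition good_walks :: "nat \<Rightarrow> ('b \<Rightarrow> 'a) \<Rightarrow> 'b \<Rightarrow> 'b list set"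
  where "good_walks k \<phi> h = {w \<in> walks k. \<phi> (h \<otimes>\<^bsub>H\<^esub> endpoint w) = \<one>\<^bsub>F\<^esub>}"

text \<open>The Markov chain behind the flow: from \<open>(\<phi>, h)\<close> with \<open>k\<close> lamps lit, follow a uniformly
  chosen good walk and light the lamp at its end with \<open>a\<close>. \<open>mass\<close> is the total expected number of
  visits to \<open>(\<phi>, h)\<close> when the chain is started once at every element of the group.\<close>

primrec mass :: "nat \<Rightarrow> ('b \<Rightarrow> 'a) \<Rightarrow> 'b \<Rightarrow> real"
  where
    "mass 0 \<phi> h = 1"
  | "mass (Suc k) \<phi> h = 1 + (if \<phi> h = a then
      \<Sum>w\<in>walks k. mass k (\<phi>(h := \<one>\<^bsub>F\<^esub>)) (h \<otimes>\<^bsub>H\<^esub> inv\<^bsub>H\<^esub> endpoint w)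
        / card (good_walks k (\<phi>(h := \<one>\<^bsub>F\<^esub>)) (h \<otimes>\<^bsub>H\<^esub> inv\<^bsub>H\<^esub> endpoint w)) else 0)"

text \<open>The mass at a configuration is shared equally among its good walks. The parameter
  \<open>k\<close> stands for the number of lit lamps of \<open>\<phi>\<close>; it is explicit so
  that \<open>mass\<close> can be defined by recursion on it.\<close>

definition rate :: "nat \<Rightarrow> ('b \<Rightarrow> 'a) \<Rightarrow> 'b \<Rightarrow> 'b list \<Rightarrow> real"
  where "rate k \<phi> h w = (if w \<in> good_walks k \<phi> h then mass k \<phi> h / card (good_walks k \<phi> h) else 0)"

text \<open>\<open>move \<phi> h d\<close> is the total mass carried from \<open>(\<phi>, h)\<close> to \<open>(\<phi>, h \<otimes> d)\<close> by walks having \<open>d\<close>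
  as the letter read at \<open>h\<close>; \<open>light \<phi> h\<close> is the mass that arrives at \<open>(\<phi>, h)\<close> and lights the lamp
  there.\<close>

definition move :: "('b \<Rightarrow> 'a) \<Rightarrow> 'b \<Rightarrow> 'b \<Rightarrow> real"
  where "move \<phi> h d = (let k = card (support \<phi>) in
    \<Sum>w\<in>walks k. \<Sum>i<scale k. if w ! i = d then rate k \<phi> (h \<otimes>\<^bsub>H\<^esub> inv\<^bsub>H\<^esub> endpoint (take i w)) w else 0)"

definition light :: "('b \<Rightarrow> 'a) \<Rightarrow> 'b \<Rightarrow> real"
  where "light \<phi> h = (let k = card (support \<phi>) in
    \<Sum>w\<in>walks k. rate k \<phi> (h \<otimes>\<^bsub>H\<^esub> inv\<^bsub>H\<^esub> endpoint w) w)"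

section \<open>Counting walks and good walks\<close>

lemma endpoint_closed: "w \<in> walks k \<Longrightarrow> endpoint w \<in> carrier H"
  using D(1) by (intro H.foldr_mult_closed) (auto simp: walks_def)

lemma finite_D: "finite D"
  using D(2) by (metis card.infinite zero_neq_numeral)

lemma finite_walks: "finite (walks k)"
  unfolding walks_def by (rule finite_lists_length_eq[OF finite_D])

lemma card_walks: "card (walks k) = 2 ^ scale k"
  unfolding walks_def using card_lists_length_eq[OF finite_D, of "scale k"] D(2) by simp

lemma scale_lower: "4 * Suc k \<le> 2 ^ scale k"
  unfolding scale_def by (rule LeastI[of _ "4 * Suc k"]) (rule less_imp_le[OF less_exp])

lemma scale_upper: "2 ^ scale k < 8 * Suc k"
proof (cases "scale k")
  case (Suc L)
  then have "L < (LEAST L. 4 * Suc k \<le> 2 ^ L)"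
    by (simp add: scale_def)
  then have "\<not> 4 * Suc k \<le> 2 ^ L"
    by (rule not_less_Least)
  with Suc show ?thesis by simp
qed simp

text \<open>Logarithms are taken in \<open>scale_upper\<close>; the constant 3 is the exponent in
  \<open>8 = 2 ^ 3\<close>.\<close>

lemma scale_le_log: "scale k \<le> 3 * (1 + ln (1 + real k)) / ln 2"
proof -
  have "real (2 ^ scale k) \<le> real (8 * Suc k)"
    using scale_upper[of k] by (intro of_nat_mono) simp
  then have "ln (2 ^ scale k :: real) \<le> ln (8 * (1 + real k))"
    by (subst ln_le_cancel_iff) auto
  also have "\<dots> = ln (2 ^ 3) + ln (1 + real k)"
    by (subst ln_mult) auto
  also have "\<dots> = 3 * ln 2 + ln (1 + real k)"
    by (subst ln_realpow) auto
  finally have "ln (2 ^ scale k :: real) \<le> 3 * ln 2 + ln (1 + real k)" .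
  then have "real (scale k) * ln 2 \<le> 3 * ln 2 + ln (1 + real k)"
    by (simp add: ln_realpow)
  also have "\<dots> \<le> 3 * 1 + 3 * ln (1 + real k)"
    using ln_2_less_1 by (intro add_mono mult_left_mono) simp_all
  finally have "real (scale k) * ln 2 \<le> 3 * (1 + ln (1 + real k))"
    by simp
  then show ?thesis
    by (simp add: field_simps)
qed

lemma inj_endpoint: "inj_on endpoint (walks k)"
  unfolding walks_def by (rule free)

lemma inj_endpoints: "h \<in> carrier H \<Longrightarrow> inj_on (\<lambda>w. h \<otimes>\<^bsub>H\<^esub> endpoint w) (walks k)"
  using endpoint_closed by (auto intro!: inj_onI dest: inj_onD[OF inj_endpoint])

text \<open>Consequently each lit lamp is the start of at most one of the walks ending at
  \<open>h\<close>, which controls the average in \<open>mass_bounds\<close>.\<close>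

lemma inj_startpoints: "h \<in> carrier H \<Longrightarrow> inj_on (\<lambda>w. h \<otimes>\<^bsub>H\<^esub> inv\<^bsub>H\<^esub> endpoint w) (walks k)"
proof (rule inj_onI)
  fix v w
  assume h: "h \<in> carrier H" and vw: "v \<in> walks k" "w \<in> walks k"
    and "h \<otimes>\<^bsub>H\<^esub> inv\<^bsub>H\<^esub> endpoint v = h \<otimes>\<^bsub>H\<^esub> inv\<^bsub>H\<^esub> endpoint w"
  then have "inv\<^bsub>H\<^esub> (inv\<^bsub>H\<^esub> endpoint v) = inv\<^bsub>H\<^esub> (inv\<^bsub>H\<^esub> endpoint w)"
    using endpoint_closed by simp
  then have "endpoint v = endpoint w"
    using vw endpoint_closed by simp
  then show "v = w"
    using inj_onD[OF inj_endpoint] vw by blast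
qed

text \<open>Distinct walks from \<open>h\<close> have distinct endpoints, so each lit lamp spoils at
  most one walk. Thus at most \<open>k\<close> walks are bad, fewer than a quarter of all.\<close>

lemma card_good_walks:
  assumes h: "h \<in> carrier H" and fin: "finite (support \<phi>)" and k: "card (support \<phi>) \<le> k"
  shows "2 ^ scale k \<le> 2 * card (good_walks k \<phi> h)"
proof -
  let ?bad = "walks k - good_walks k \<phi> h"
  have "card ?bad \<le> card (support \<phi>)"
    by (rule card_inj_on_le[of "\<lambda>w. h \<otimes>\<^bsub>H\<^esub> endpoint w", OF _ _ fin])
      (use inj_endpoints[OF h] h endpoint_closed in \<open>auto simp: good_walks_def support_def inj_on_def\<close>)
  moreover have "card (walks k) = card (good_walks k \<phi> h) + card ?bad"
    using finite_walks by (subst card_Diff_subset)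
      (auto simp: good_walks_def intro: card_mono finite_subset le_add_diff_inverse[symmetric])
  ultimately show ?thesis
    using scale_lower[of k] k card_walks by simp
qed

section \<open>The uniform bound on the mass\<close>

lemma support_fun_upd_one: "support (\<phi>(h := \<one>\<^bsub>F\<^esub>)) = support \<phi> - {h}"
  by (auto simp: support_def)

lemma mass_unlit: "\<phi> h \<noteq> a \<Longrightarrow> mass k \<phi> h = 1"
  by (cases k) auto

text \<open>A lit lamp may carry mass 6, but a ball of walks has more than four times as many points as
  there are lit lamps, so the average over the ball stays below \<open>5/2\<close>.\<close>

lemma mass_bounds:
  "finite (support \<phi>) \<Longrightarrow> card (support \<phi>) = k \<Longrightarrow> h \<in> carrier H \<Longrightarrow> 0 \<le> mass k \<phi> h \<and> mass k \<phi> h \<le> 6"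
proof (induction k arbitrary: \<phi> h)
  case (Suc k)
  show ?case
  proof (cases "\<phi> h = a")
    case True
    define \<psi> where "\<psi> = \<phi>(h := \<one>\<^bsub>F\<^esub>)"
    let ?g = "\<lambda>w. h \<otimes>\<^bsub>H\<^esub> inv\<^bsub>H\<^esub> endpoint w"
    let ?N = "2 ^ scale k :: real"
    have "h \<in> support \<phi>"
      using Suc.prems True a by (simp add: support_def)
    then have supp: "finite (support \<psi>)" "card (support \<psi>) = k"
      using Suc.prems by (simp_all add: \<psi>_def support_fun_upd_one)
    have g: "?g w \<in> carrier H" if "w \<in> walks k" for w
      using that endpoint_closed Suc.prems by blast
    have nonneg: "0 \<le> mass k \<psi> (?g w)" if "w \<in> walks k" for w
      using Suc.IH[OF supp g[OF that]] by simp
    \<comment> \<open>By induction a lit position carries at most \<open>6 = 1 + 5\<close>; an unlit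
      one carries exactly its own unit, since its lamp does not show \<open>a\<close>.\<close>
    have le: "mass k \<psi> (?g w) \<le> 1 + 5 * of_bool (?g w \<in> support \<psi>)" if "w \<in> walks k" for w
      using Suc.IH[OF supp g[OF that]] mass_unlit[of \<psi> "?g w" k] g[OF that] a(2)
      by (auto simp: support_def)
    have inv_card: "1 / card (good_walks k \<psi> (?g w)) \<le> 2 / ?N" if "w \<in> walks k" for w
    proof -
      have "2 ^ scale k \<le> 2 * card (good_walks k \<psi> (?g w))"
        using card_good_walks[OF g[OF that] supp(1)] supp(2) by simp
      then have "real (2 ^ scale k) \<le> real (2 * card (good_walks k \<psi> (?g w)))"
        by (rule of_nat_mono)
      then have "?N \<le> 2 * real (card (good_walks k \<psi> (?g w)))"
        by simp
      moreover have "0 < ?N" by simp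
      ultimately have "0 < real (card (good_walks k \<psi> (?g w)))" by linarith
      then show ?thesis
        using \<open>?N \<le> _\<close> by (simp add: field_simps)
    qed
    have "(\<Sum>w\<in>walks k. mass k \<psi> (?g w) / card (good_walks k \<psi> (?g w)))
        \<le> (\<Sum>w\<in>walks k. (1 + 5 * of_bool (?g w \<in> support \<psi>)) * (2 / ?N))"
    proof (rule sum_mono)
      fix w assume w: "w \<in> walks k"
      have "mass k \<psi> (?g w) * (1 / card (good_walks k \<psi> (?g w)))
          \<le> (1 + 5 * of_bool (?g w \<in> support \<psi>)) * (2 / ?N)"
        using le[OF w] inv_card[OF w] nonneg[OF w] by (intro mult_mono) auto
      then show "mass k \<psi> (?g w) / card (good_walks k \<psi> (?g w))
          \<le> (1 + 5 * of_bool (?g w \<in> support \<psi>)) * (2 / ?N)"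
        by simp
    qed
    also have "\<dots> = (?N + 5 * real (card {w \<in> walks k. ?g w \<in> support \<psi>})) * (2 / ?N)"
    proof -
      have "(\<Sum>w\<in>walks k. of_bool (?g w \<in> support \<psi>)) = real (card {w \<in> walks k. ?g w \<in> support \<psi>})"
        using finite_walks by (simp add: sum_of_bool_eq Int_def)
      then show ?thesis
        by (simp only: sum_distrib_right[symmetric] sum.distrib sum_distrib_left[symmetric]
            sum_constant card_walks) simp
    qed
    also have "\<dots> \<le> (?N + 5 * real k) * (2 / ?N)"
    proof -
      have "card {w \<in> walks k. ?g w \<in> support \<psi>} \<le> card (support \<psi>)"
        by (rule card_inj_on_le[of ?g, OF _ _ supp(1)])
          (use inj_startpoints[OF Suc.prems(3), of k] in \<open>auto simp: inj_on_def\<close>)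
      then show ?thesis
        using supp(2) by (intro mult_right_mono) auto
    qed
    \<comment> \<open>The left side is \<open>2 + 10 * k / ?N\<close>, at most \<open>9/2\<close>
      because \<open>4 * k \<le> ?N\<close>. With the unit started at the configuration itself the
      total is again at most 6, so the induction closes.\<close>
    also have "\<dots> \<le> 5"
    proof -
      have "real (4 * Suc k) \<le> real (2 ^ scale k)"
        using scale_lower by (rule of_nat_mono)
      then have "4 * (real k + 1) \<le> ?N" by simp
      then show ?thesis by (simp add: field_simps)
    qed
    finally have "(\<Sum>w\<in>walks k. mass k \<psi> (?g w) / card (good_walks k \<psi> (?g w))) \<le> 5" .
    moreover have "0 \<le> (\<Sum>w\<in>walks k. mass k \<psi> (?g w) / card (good_walks k \<psi> (?g w)))"
      using nonneg by (intro sum_nonneg divide_nonneg_nonneg) auto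
    ultimately show ?thesis
      using True by (simp add: \<psi>_def)
  qed simp
qed simp

section \<open>Balance and load of the flow\<close>

lemma rate_bound:
  assumes "finite (support \<phi>)" "card (support \<phi>) = k" "h \<in> carrier H"
  shows "\<bar>rate k \<phi> h w\<bar> \<le> 12 / 2 ^ scale k"
proof -
  have m: "0 \<le> mass k \<phi> h" "mass k \<phi> h \<le> 6"
    using mass_bounds[OF assms] by auto
  have "2 ^ scale k \<le> 2 * card (good_walks k \<phi> h)"
    using card_good_walks assms by simp
  then have "real (2 ^ scale k) \<le> real (2 * card (good_walks k \<phi> h))"
    by (rule of_nat_mono)
  then have N: "2 ^ scale k \<le> 2 * real (card (good_walks k \<phi> h))"
    by simp
  have "mass k \<phi> h / card (good_walks k \<phi> h) \<le> 6 / (2 ^ scale k / 2)"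
    using m N by (intro frac_le) auto
  then show ?thesis
    using m by (simp add: rate_def)
qed

text \<open>At least one walk is good, so the division in \<open>rate\<close> is never by zero and
  all mass leaves the configuration.\<close>

lemma sum_rate:
  assumes "finite (support \<phi>)" "card (support \<phi>) = k" "h \<in> carrier H"
  shows "(\<Sum>w\<in>walks k. rate k \<phi> h w) = mass k \<phi> h"
proof -
  have "0 < card (good_walks k \<phi> h)"
    using card_good_walks[OF assms(3,1), of k] assms(2)
    by (cases "card (good_walks k \<phi> h) = 0") simp_all
  moreover have "(\<Sum>w\<in>walks k. rate k \<phi> h w) = (\<Sum>w\<in>good_walks k \<phi> h. rate k \<phi> h w)"
    using finite_walks by (intro sum.mono_neutral_right) (auto simp: good_walks_def rate_def)
  ultimately show ?thesis
    by (simp add: rate_def)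
qed

text \<open>Being good is decided at the endpoint. For walks that end at \<open>u\<close> it depends
  only on the lamp at \<open>u\<close>.\<close>

lemma rate_into:
  assumes "u \<in> carrier H" "w \<in> walks k"
  shows "rate k \<phi> (u \<otimes>\<^bsub>H\<^esub> inv\<^bsub>H\<^esub> endpoint w) w = (if \<phi> u = \<one>\<^bsub>F\<^esub> then
    mass k \<phi> (u \<otimes>\<^bsub>H\<^esub> inv\<^bsub>H\<^esub> endpoint w) / card (good_walks k \<phi> (u \<otimes>\<^bsub>H\<^esub> inv\<^bsub>H\<^esub> endpoint w)) else 0)"
  using assms endpoint_closed[OF assms(2)] by (simp add: rate_def good_walks_def H.m_assoc)

lemma light_lit: "u \<in> carrier H \<Longrightarrow> \<phi> u \<noteq> \<one>\<^bsub>F\<^esub> \<Longrightarrow> light \<phi> u = 0"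
  by (simp add: light_def rate_into Let_def)

text \<open>The recursion of \<open>mass\<close> read as conservation: besides its own unit,
  \<open>(\<phi>, u)\<close> receives mass only from the configuration where the lamp at
  \<open>u\<close> is still off, and only if that lamp now shows \<open>a\<close>.\<close>

lemma mass_balance:
  assumes fin: "finite (support \<phi>)" and u: "u \<in> carrier H"
  shows "mass (card (support \<phi>)) \<phi> u = 1 + (if \<phi> u = a then light (\<phi>(u := \<one>\<^bsub>F\<^esub>)) u else 0)"
proof (cases "\<phi> u = a")
  case True
  then have "u \<in> support \<phi>"
    using u a by (simp add: support_def)
  then obtain k where k: "card (support \<phi>) = Suc k" "card (support (\<phi>(u := \<one>\<^bsub>F\<^esub>))) = k"
    using fin by (metis card_Suc_Diff1 support_fun_upd_one)
  show ?thesis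
    using True u by (simp add: k light_def Let_def rate_into cong: sum.cong del: fun_upd_apply) simp
qed (simp add: mass_unlit)

text \<open>A walk that stands at \<open>u\<close> after \<open>i\<close> letters leaves along
  letter \<open>i\<close>, and one that stands there after \<open>Suc i\<close> letters has entered
  along letter \<open>i\<close>. Summed over \<open>i\<close> this telescopes: what remains are the
  walks starting at \<open>u\<close>, with total \<open>mass\<close>, minus those ending there, with
  total \<open>light\<close>.\<close>

lemma move_balance:
  assumes fin: "finite (support \<phi>)" and u: "u \<in> carrier H"
  shows "(\<Sum>d\<in>D. move \<phi> u d) - (\<Sum>d\<in>D. move \<phi> (u \<otimes>\<^bsub>H\<^esub> inv\<^bsub>H\<^esub> d) d)
    = mass (card (support \<phi>)) \<phi> u - light \<phi> u"
proof -
  define k where "k = card (support \<phi>)"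
  define r where "r w i = rate k \<phi> (u \<otimes>\<^bsub>H\<^esub> inv\<^bsub>H\<^esub> endpoint (take i w)) w" for w i
  have letter: "w ! i \<in> D" if "w \<in> walks k" "i < scale k" for w i
    using that by (auto simp: walks_def)
  have collect: "(\<Sum>d\<in>D. \<Sum>w\<in>walks k. \<Sum>i<scale k. if w ! i = d then c w i d else 0)
      = (\<Sum>w\<in>walks k. \<Sum>i<scale k. c w i (w ! i))" for c :: "'b list \<Rightarrow> nat \<Rightarrow> 'b \<Rightarrow> real"
  proof -
    have "(\<Sum>d\<in>D. \<Sum>w\<in>walks k. \<Sum>i<scale k. if w ! i = d then c w i d else 0)
        = (\<Sum>w\<in>walks k. \<Sum>i<scale k. \<Sum>d\<in>D. if w ! i = d then c w i d else 0)"
      by (subst sum.swap) (intro sum.cong refl sum.swap)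
    also have "\<dots> = (\<Sum>w\<in>walks k. \<Sum>i<scale k. c w i (w ! i))"
      using letter finite_D by (intro sum.cong refl) auto
    finally show ?thesis .
  qed
  have "(\<Sum>d\<in>D. move \<phi> u d) = (\<Sum>w\<in>walks k. \<Sum>i<scale k. r w i)"
    unfolding move_def Let_def k_def[symmetric] r_def by (rule collect)
  moreover have "(\<Sum>d\<in>D. move \<phi> (u \<otimes>\<^bsub>H\<^esub> inv\<^bsub>H\<^esub> d) d) = (\<Sum>w\<in>walks k. \<Sum>i<scale k. r w (Suc i))"
  proof -
    \<comment> \<open>The start of a walk that reads letter \<open>i\<close> just before arriving at
      \<open>u\<close>: going back over this letter and then over the first \<open>i\<close> letters
      is going back over \<open>Suc i\<close> letters.\<close>
    have "u \<otimes>\<^bsub>H\<^esub> inv\<^bsub>H\<^esub> (w ! i) \<otimes>\<^bsub>H\<^esub> inv\<^bsub>H\<^esub> endpoint (take i w) = u \<otimes>\<^bsub>H\<^esub> inv\<^bsub>H\<^esub> endpoint (take (Suc i) w)"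
      if w: "w \<in> walks k" and i: "i < scale k" for w i
    proof -
      have "set (take i w) \<subseteq> carrier H" and wi: "w ! i \<in> carrier H"
        using w D(1) letter[OF w i] set_take_subset[of i w] by (auto simp: walks_def)
      moreover have "take (Suc i) w = take i w @ [w ! i]"
        using w i by (simp add: walks_def take_Suc_conv_app_nth)
      ultimately have "endpoint (take (Suc i) w) = endpoint (take i w) \<otimes>\<^bsub>H\<^esub> w ! i"
        using H.foldr_mult_append[of "take i w" "[w ! i]"] by simp
      then show ?thesis
        using u wi H.foldr_mult_closed[OF \<open>set (take i w) \<subseteq> carrier H\<close>]
        by (simp add: H.inv_mult_group H.m_assoc)
    qed
    then show ?thesis
      unfolding move_def Let_def k_def[symmetric] r_def
      by (subst collect) (auto intro!: sum.cong)
  qed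
  ultimately have "(\<Sum>d\<in>D. move \<phi> u d) - (\<Sum>d\<in>D. move \<phi> (u \<otimes>\<^bsub>H\<^esub> inv\<^bsub>H\<^esub> d) d)
      = (\<Sum>w\<in>walks k. r w 0 - r w (scale k))"
    by (simp add: sum_subtractf[symmetric] sum_lessThan_telescope')
  also have "\<dots> = (\<Sum>w\<in>walks k. rate k \<phi> u w) - light \<phi> u"
    using u by (auto simp: sum_subtractf light_def r_def walks_def k_def[symmetric] intro!: sum.cong)
  finally show ?thesis
    using sum_rate[OF fin _ u] by (simp add: k_def)
qed

lemma light_bound:
  assumes fin: "finite (support \<phi>)" and u: "u \<in> carrier H"
  shows "\<bar>light \<phi> u\<bar> \<le> 12"
proof -
  define k where "k = card (support \<phi>)"
  have "\<bar>light \<phi> u\<bar> \<le> (\<Sum>w\<in>walks k. \<bar>rate k \<phi> (u \<otimes>\<^bsub>H\<^esub> inv\<^bsub>H\<^esub> endpoint w) w\<bar>)"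
    unfolding light_def Let_def k_def by (rule sum_abs)
  also have "\<dots> \<le> real (card (walks k)) * (12 / 2 ^ scale k)"
    using rate_bound[OF fin k_def[symmetric]] u endpoint_closed by (intro sum_bounded_above) simp
  finally show ?thesis
    by (simp add: card_walks)
qed

text \<open>There are \<open>2 ^ scale k\<close> walks of rate at most
  \<open>12 / 2 ^ scale k\<close>, and each is counted at most once per letter index. The letter
  indices contribute the factor \<open>scale\<close>, absent from
  \<open>light_bound\<close>.\<close>

lemma move_bound:
  assumes fin: "finite (support \<phi>)" and u: "u \<in> carrier H"
  shows "\<bar>move \<phi> u d\<bar> \<le> 12 * scale (card (support \<phi>))"
proof -
  define k where "k = card (support \<phi>)"
  let ?r = "\<lambda>w i. if w ! i = d then rate k \<phi> (u \<otimes>\<^bsub>H\<^esub> inv\<^bsub>H\<^esub> endpoint (take i w)) w else 0"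
  have r: "\<bar>?r w i\<bar> \<le> 12 / 2 ^ scale k" if "w \<in> walks k" for w i
  proof -
    have "set (take i w) \<subseteq> carrier H"
      using that D(1) set_take_subset[of i w] by (auto simp: walks_def)
    then have "u \<otimes>\<^bsub>H\<^esub> inv\<^bsub>H\<^esub> endpoint (take i w) \<in> carrier H"
      using u H.foldr_mult_closed by blast
    then show ?thesis
      using rate_bound[OF fin k_def[symmetric]] by simp
  qed
  have "\<bar>move \<phi> u d\<bar> \<le> (\<Sum>w\<in>walks k. \<bar>\<Sum>i<scale k. ?r w i\<bar>)"
    unfolding move_def Let_def k_def by (rule sum_abs)
  also have "\<dots> \<le> real (card (walks k)) * (real (scale k) * (12 / 2 ^ scale k))"
  proof (rule sum_bounded_above)
    fix w assume w: "w \<in> walks k"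
    have "\<bar>\<Sum>i<scale k. ?r w i\<bar> \<le> (\<Sum>i<scale k. \<bar>?r w i\<bar>)"
      by (rule sum_abs)
    also have "\<dots> \<le> real (card {..<scale k}) * (12 / 2 ^ scale k)"
      using r[OF w] by (intro sum_bounded_above)
    finally show "\<bar>\<Sum>i<scale k. ?r w i\<bar> \<le> real (scale k) * (12 / 2 ^ scale k)"
      by simp
  qed
  finally show ?thesis
    by (simp add: card_walks k_def)
qed

section \<open>Moving and lighting as right multiplication in the wreath product\<close>

definition step :: "'b \<Rightarrow> ('b \<Rightarrow> 'a) \<times> 'b"
  where "step d = (\<lambda>h\<in>carrier H. \<one>\<^bsub>F\<^esub>, d)"

definition lamp :: "'a \<Rightarrow> ('b \<Rightarrow> 'a) \<times> 'b"
  where "lamp b = ((\<lambda>h\<in>carrier H. \<one>\<^bsub>F\<^esub>)(\<one>\<^bsub>H\<^esub> := b), \<one>\<^bsub>H\<^esub>)"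

abbreviation \<Gamma> :: "(('b \<Rightarrow> 'a) \<times> 'b) monoid"
  where "\<Gamma> \<equiv> wreath_product F H"

sublocale W: group \<Gamma>
  by (rule group_wreath_product[OF F.is_group H.is_group])

lemma carrier_wreath:
  "x \<in> carrier \<Gamma> \<longleftrightarrow> fst x \<in> carrier H \<rightarrow>\<^sub>E carrier F \<and> finite (support (fst x)) \<and> snd x \<in> carrier H"
  by (cases x) (auto simp: carrier_wreath_product[OF F.is_group] support_def)

lemma step_closed: "d \<in> carrier H \<Longrightarrow> step d \<in> carrier \<Gamma>"
  by (auto simp: carrier_wreath step_def support_def)

lemma lamp_closed: "b \<in> carrier F \<Longrightarrow> lamp b \<in> carrier \<Gamma>"
  by (auto simp: carrier_wreath lamp_def support_def PiE_iff extensional_def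
      intro: finite_subset[of _ "{\<one>\<^bsub>H\<^esub>}"])

lemma mult_step:
  assumes "(\<phi>, u) \<in> carrier \<Gamma>" "d \<in> carrier H"
  shows "(\<phi>, u) \<otimes>\<^bsub>\<Gamma>\<^esub> step d = (\<phi>, u \<otimes>\<^bsub>H\<^esub> d)"
  using assms by (auto simp: carrier_wreath step_def mult_wreath_product PiE_iff extensional_def)

lemma mult_lamp:
  assumes "(\<phi>, u) \<in> carrier \<Gamma>" "b \<in> carrier F"
  shows "(\<phi>, u) \<otimes>\<^bsub>\<Gamma>\<^esub> lamp b = (\<phi>(u := \<phi> u \<otimes>\<^bsub>F\<^esub> b), u)"
proof -
  have "inv\<^bsub>H\<^esub> u \<otimes>\<^bsub>H\<^esub> x = \<one>\<^bsub>H\<^esub> \<longleftrightarrow> x = u" if "x \<in> carrier H" for x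
    using that assms by (metis H.inv_closed H.inv_equality H.inv_inv H.l_inv carrier_wreath snd_conv)
  then show ?thesis
    using assms by (auto simp: carrier_wreath lamp_def mult_wreath_product PiE_iff extensional_def)
qed

lemma inv_step: "d \<in> carrier H \<Longrightarrow> inv\<^bsub>\<Gamma>\<^esub> step d = step (inv\<^bsub>H\<^esub> d)"
  using mult_step[of "fst (step (inv\<^bsub>H\<^esub> d))" "inv\<^bsub>H\<^esub> d" d] step_closed[of d] step_closed[of "inv\<^bsub>H\<^esub> d"]
  by (intro W.inv_equality) (auto simp: step_def one_wreath_product)

lemma inv_lamp: "b \<in> carrier F \<Longrightarrow> inv\<^bsub>\<Gamma>\<^esub> lamp b = lamp (inv\<^bsub>F\<^esub> b)"
  using mult_lamp[of "fst (lamp (inv\<^bsub>F\<^esub> b))" "\<one>\<^bsub>H\<^esub>" b] lamp_closed[of b] lamp_closed[of "inv\<^bsub>F\<^esub> b"]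
  by (intro W.inv_equality) (auto simp: lamp_def one_wreath_product)

text \<open>A lamp lit in the product is lit in \<open>x\<close>, or is the translate by the
  position of \<open>x\<close> of a lamp lit in \<open>y\<close>.\<close>

lemma card_support_mult:
  assumes x: "x \<in> carrier \<Gamma>" and y: "y \<in> carrier \<Gamma>"
  shows "card (support (fst (x \<otimes>\<^bsub>\<Gamma>\<^esub> y))) \<le> card (support (fst x)) + card (support (fst y))"
proof -
  obtain \<phi> h \<psi> k where [simp]: "x = (\<phi>, h)" "y = (\<psi>, k)"
    by fastforce
  have fin: "finite (support \<phi>)" "finite (support \<psi>)" and h: "h \<in> carrier H"
    using x y by (auto simp: carrier_wreath)
  have "support (fst (x \<otimes>\<^bsub>\<Gamma>\<^esub> y)) \<subseteq> support \<phi> \<union> (\<lambda>k. h \<otimes>\<^bsub>H\<^esub> k) ` support \<psi>"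
  proof
    fix g assume g: "g \<in> support (fst (x \<otimes>\<^bsub>\<Gamma>\<^esub> y))"
    then have "g = h \<otimes>\<^bsub>H\<^esub> (inv\<^bsub>H\<^esub> h \<otimes>\<^bsub>H\<^esub> g)"
      using h by (simp add: support_def H.m_assoc[symmetric])
    moreover have "g \<in> support \<phi> \<or> inv\<^bsub>H\<^esub> h \<otimes>\<^bsub>H\<^esub> g \<in> support \<psi>"
      using g h by (auto simp: support_def mult_wreath_product)
    ultimately show "g \<in> support \<phi> \<union> (\<lambda>k. h \<otimes>\<^bsub>H\<^esub> k) ` support \<psi>"
      by blast
  qed
  then have "card (support (fst (x \<otimes>\<^bsub>\<Gamma>\<^esub> y))) \<le> card (support \<phi> \<union> (\<lambda>k. h \<otimes>\<^bsub>H\<^esub> k) ` support \<psi>)"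
    using fin by (intro card_mono) auto
  also have "\<dots> \<le> card (support \<phi>) + card ((\<lambda>k. h \<otimes>\<^bsub>H\<^esub> k) ` support \<psi>)"
    by (rule card_Un_le)
  also have "card ((\<lambda>k. h \<otimes>\<^bsub>H\<^esub> k) ` support \<psi>) \<le> card (support \<psi>)"
    by (rule card_image_le[OF fin(2)])
  finally show ?thesis by simp
qed

lemma card_support_linear:
  assumes S: "finite_symmetric_generating_set \<Gamma> S"
  shows "\<exists>c::nat. \<forall>x\<in>carrier \<Gamma>. real (card (support (fst x))) \<le> real c * word_dist \<Gamma> S x \<one>\<^bsub>\<Gamma>\<^esub>"
proof -
  define c where "c = Max (insert 0 ((\<lambda>s. card (support (fst s))) ` S))"
  have fin: "finite S" and SG: "S \<subseteq> carrier \<Gamma>" and inv: "\<And>s. s \<in> S \<Longrightarrow> inv\<^bsub>\<Gamma>\<^esub> s \<in> S"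
    using S by (auto simp: finite_symmetric_generating_set_def)
  have c: "card (support (fst s)) \<le> c" if "s \<in> S" for s
    unfolding c_def using fin that by (intro Max_ge) auto
  \<comment> \<open>The inverse appears because \<open>word_dist \<Gamma> S x \<one>\<close> is the
    word length of the inverse of \<open>x\<close>. A word of that length spells this inverse, and
    \<open>x\<close> is recovered by inverting the word.\<close>
  have word: "card (support (fst (inv\<^bsub>\<Gamma>\<^esub> foldr (\<otimes>\<^bsub>\<Gamma>\<^esub>) w \<one>\<^bsub>\<Gamma>\<^esub>))) \<le> c * length w"
    if "set w \<subseteq> S" for w
    using that
  proof (induction w)
    case Nil
    have "support (fst \<one>\<^bsub>\<Gamma>\<^esub>) = {}"
      by (auto simp: one_wreath_product support_def)
    then show ?case by simp
  next
    case (Cons s w)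
    let ?p = "foldr (\<otimes>\<^bsub>\<Gamma>\<^esub>) w \<one>\<^bsub>\<Gamma>\<^esub>"
    have s: "s \<in> S" "s \<in> carrier \<Gamma>" and p: "?p \<in> carrier \<Gamma>"
      using Cons.prems SG by (auto intro!: W.foldr_mult_closed)
    then have "card (support (fst (inv\<^bsub>\<Gamma>\<^esub> (s \<otimes>\<^bsub>\<Gamma>\<^esub> ?p))))
        \<le> card (support (fst (inv\<^bsub>\<Gamma>\<^esub> ?p))) + card (support (fst (inv\<^bsub>\<Gamma>\<^esub> s)))"
      using card_support_mult[of "inv\<^bsub>\<Gamma>\<^esub> ?p" "inv\<^bsub>\<Gamma>\<^esub> s"] by (simp add: W.inv_mult_group)
    also have "\<dots> \<le> c * length w + c"
      using Cons c[OF inv[OF s(1)]] by (intro add_mono) auto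
    finally show ?case by simp
  qed
  have "real (card (support (fst x))) \<le> real c * word_dist \<Gamma> S x \<one>\<^bsub>\<Gamma>\<^esub>" if x: "x \<in> carrier \<Gamma>" for x
  proof -
    obtain w where "length w = word_length \<Gamma> S (inv\<^bsub>\<Gamma>\<^esub> x)" "set w \<subseteq> S"
        "foldr (\<otimes>\<^bsub>\<Gamma>\<^esub>) w \<one>\<^bsub>\<Gamma>\<^esub> = inv\<^bsub>\<Gamma>\<^esub> x"
      using W.word_length_attained[OF S, of "inv\<^bsub>\<Gamma>\<^esub> x"] x by auto
    with word[of w] x have "card (support (fst x)) \<le> c * word_length \<Gamma> S (inv\<^bsub>\<Gamma>\<^esub> x)"
      by simp
    then have "real (card (support (fst x))) \<le> real (c * word_length \<Gamma> S (inv\<^bsub>\<Gamma>\<^esub> x))"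
      by (rule of_nat_mono)
    then show ?thesis
      using x by (simp add: word_dist_def)
  qed
  then show ?thesis by blast
qed

theorem fundamental_class_log_eq_one:
  assumes S: "finite_symmetric_generating_set \<Gamma> S"
  shows "fundamental_class \<Gamma> S (\<lambda>t. 1 + ln (1 + t)) = \<one>\<^bsub>growth_homology_group \<Gamma> S (\<lambda>t. 1 + ln (1 + t)) 0\<^esub>"
proof -
  \<comment> \<open>The flow runs along the two moves and along lighting a lamp with
    \<open>a\<close>.\<close>
  define Q where "Q = insert (lamp a) (step ` D)"
  define e where "e x q = (if q = lamp a then light (fst x) (snd x) else move (fst x) (snd x) (snd q))"
    for x q :: "('b \<Rightarrow> 'a) \<times> 'b"
  have lamp_step: "lamp a \<noteq> step d" for d
  proof
    assume "lamp a = step d"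
    then have "fst (lamp a) \<one>\<^bsub>H\<^esub> = fst (step d) \<one>\<^bsub>H\<^esub>" by simp
    then show False using a by (simp add: lamp_def step_def)
  qed
  have sum_Q: "sum g Q = g (lamp a) + (\<Sum>d\<in>D. g (step d))" for g :: "_ \<Rightarrow> real"
  proof -
    have "inj_on step D" by (simp add: inj_on_def step_def)
    then show ?thesis
      unfolding Q_def using finite_D lamp_step by (subst sum.insert) (auto simp: sum.reindex)
  qed
  have Q: "finite Q" "Q \<subseteq> carrier \<Gamma>"
    using finite_D D(1) a lamp_closed step_closed by (auto simp: Q_def)
  obtain c :: nat where c:
    "\<And>x. x \<in> carrier \<Gamma> \<Longrightarrow> real (card (support (fst x))) \<le> real c * word_dist \<Gamma> S x \<one>\<^bsub>\<Gamma>\<^esub>"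
    using card_support_linear[OF S] by blast
  \<comment> \<open>The load is at most \<open>12 * scale k\<close>, and \<open>scale_le_log\<close>
    contributes \<open>3 / ln 2\<close>, giving \<open>36 / ln 2\<close>. The other factor comes
    from \<open>k \<le> c * t\<close>, which gives \<open>1 + k \<le> (1 + c) * (1 + t)\<close> and
    hence splits the logarithm.\<close>
  define K where "K = 36 / ln 2 * (1 + ln (1 + real c))"
  have "0 \<le> K"
    by (simp add: K_def)
  have growth: "\<bar>e x q\<bar> \<le> K * (1 + ln (1 + word_dist \<Gamma> S x \<one>\<^bsub>\<Gamma>\<^esub>))" if x: "x \<in> carrier \<Gamma>" for x q
  proof -
    let ?t = "word_dist \<Gamma> S x \<one>\<^bsub>\<Gamma>\<^esub>"
    let ?k = "card (support (fst x))"
    have fin: "finite (support (fst x))" and u: "snd x \<in> carrier H"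
      using x by (auto simp: carrier_wreath)
    have t: "0 \<le> ?t" by (simp add: word_dist_def)
    \<comment> \<open>\<open>scale\<close> is at least 1, so the constant bound 12 on
      \<open>light\<close> is absorbed into the bound on \<open>move\<close>.\<close>
    have "2 ^ 0 < (2::nat) ^ scale ?k"
      using scale_lower[of ?k] by simp
    then have "1 \<le> scale ?k"
      by (subst (asm) power_strict_increasing_iff) auto
    then have "\<bar>e x q\<bar> \<le> 12 * real (scale ?k)"
      using light_bound[OF fin u] move_bound[OF fin u] by (fastforce simp: e_def)
    also have "\<dots> \<le> 36 / ln 2 * (1 + ln (1 + real ?k))"
      using mult_left_mono[OF scale_le_log[of ?k], of 12]
      by (simp only: times_divide_eq_right times_divide_eq_left) simp
    also have "\<dots> \<le> 36 / ln 2 * ((1 + ln (1 + real c)) * (1 + ln (1 + ?t)))"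
    proof (intro mult_left_mono)
      have "1 + real ?k \<le> (1 + real c) * (1 + ?t)"
        using c[OF x] t by (simp add: algebra_simps)
      then have "ln (1 + real ?k) \<le> ln ((1 + real c) * (1 + ?t))"
        by (subst ln_le_cancel_iff) (use t in \<open>auto intro!: mult_pos_pos add_pos_nonneg\<close>)
      also have "\<dots> = ln (1 + real c) + ln (1 + ?t)"
        using t by (subst ln_mult) auto
      finally have "ln (1 + real ?k) \<le> ln (1 + real c) + ln (1 + ?t)" .
      moreover have "0 \<le> ln (1 + real c) * ln (1 + ?t)"
        using t by (intro mult_nonneg_nonneg ln_ge_zero) auto
      ultimately show "1 + ln (1 + real ?k) \<le> (1 + ln (1 + real c)) * (1 + ln (1 + ?t))"
        by (simp add: algebra_simps)
    qed simp
    finally show ?thesis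
      by (simp only: K_def mult.assoc)
  qed
  have div: "(\<Sum>q\<in>Q. e x q) - (\<Sum>q\<in>Q. e (x \<otimes>\<^bsub>\<Gamma>\<^esub> inv\<^bsub>\<Gamma>\<^esub> q) q) = 1" if x: "x \<in> carrier \<Gamma>" for x
  proof -
    obtain \<phi> u where [simp]: "x = (\<phi>, u)"
      by (rule prod.exhaust)
    have \<phi>: "\<phi> u \<in> carrier F" "finite (support \<phi>)" and u: "u \<in> carrier H"
      using x by (auto simp: carrier_wreath)
    have "(\<Sum>q\<in>Q. e (x \<otimes>\<^bsub>\<Gamma>\<^esub> inv\<^bsub>\<Gamma>\<^esub> q) q)
        = light (\<phi>(u := \<phi> u \<otimes>\<^bsub>F\<^esub> inv\<^bsub>F\<^esub> a)) u + (\<Sum>d\<in>D. move \<phi> (u \<otimes>\<^bsub>H\<^esub> inv\<^bsub>H\<^esub> d) d)"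
    proof -
      have "e (x \<otimes>\<^bsub>\<Gamma>\<^esub> inv\<^bsub>\<Gamma>\<^esub> step d) (step d) = move \<phi> (u \<otimes>\<^bsub>H\<^esub> inv\<^bsub>H\<^esub> d) d" if "d \<in> D" for d
        using that D(1) x mult_step[of \<phi> u "inv\<^bsub>H\<^esub> d"] lamp_step[of d]
        by (auto simp: e_def inv_step subset_iff) (auto simp: step_def)
      moreover have "e (x \<otimes>\<^bsub>\<Gamma>\<^esub> inv\<^bsub>\<Gamma>\<^esub> lamp a) (lamp a) = light (\<phi>(u := \<phi> u \<otimes>\<^bsub>F\<^esub> inv\<^bsub>F\<^esub> a)) u"
        using a x mult_lamp[of \<phi> u "inv\<^bsub>F\<^esub> a"] by (simp add: e_def inv_lamp)
      ultimately show ?thesis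
        by (simp add: sum_Q)
    qed
    moreover have "(\<Sum>q\<in>Q. e x q) = light \<phi> u + (\<Sum>d\<in>D. move \<phi> u d)"
      using lamp_step by (simp add: sum_Q e_def lamp_step[symmetric]) (simp add: step_def)
    \<comment> \<open>Before lighting, the lamp at \<open>u\<close> showed \<open>\<phi> u\<close>
      times the inverse of \<open>a\<close>. It was off exactly when \<open>\<phi> u = a\<close>; in
      every other case no walk ends there, by \<open>light_lit\<close>.\<close>
    moreover have "light (\<phi>(u := \<phi> u \<otimes>\<^bsub>F\<^esub> inv\<^bsub>F\<^esub> a)) u = (if \<phi> u = a then light (\<phi>(u := \<one>\<^bsub>F\<^esub>)) u else 0)"
    proof (cases "\<phi> u = a")
      case False
      then have "\<phi> u \<otimes>\<^bsub>F\<^esub> inv\<^bsub>F\<^esub> a \<noteq> \<one>\<^bsub>F\<^esub>"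
        using a \<phi> by (metis F.inv_closed F.inv_equality F.inv_inv)
      with False show ?thesis
        using u by (simp add: light_lit)
    qed (use a in simp)
    \<comment> \<open>The outgoing \<open>light \<phi> u\<close> cancels the mass that stops moving
      at \<open>u\<close>, and the incoming light is exactly what \<open>mass\<close> exceeds 1
      by.\<close>
    ultimately show ?thesis
      using move_balance[OF \<phi>(2) u] mass_balance[OF \<phi>(2) u] by linarith
  qed
  have "mono_on {0..} (\<lambda>t::real. 1 + ln (1 + t))"
    using growth_function_log by (simp add: growth_function_def)
  then show ?thesis
    using growth \<open>0 \<le> K\<close> div
    by (intro W.fundamental_class_eq_one[OF S] W.fundamental_cycle_boundaryI[OF S Q, where e = e and K = K])
qed

end

section \<open>A free semigroup in the lamplighter group\<close>

text \<open>Both elements of \<open>D\<close> shift by 1 and differ only in whether they light the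
  lamp at 0, so the lamps of a product spell out the word. The first letter is read off at 0 and
  cancelled, and induction does the rest.\<close>

lemma lamplighter_free_semigroup:
  fixes F :: "('a, 'm) monoid_scheme"
  assumes F: "group F" and a: "a \<in> carrier F" "a \<noteq> \<one>\<^bsub>F\<^esub>"
  defines "D \<equiv> {(\<lambda>_. \<one>\<^bsub>F\<^esub>, 1), ((\<lambda>_. \<one>\<^bsub>F\<^esub>)(0 := a), 1)} :: ((int \<Rightarrow> 'a) \<times> int) set"
  shows "free_semigroup_wreath F (wreath_product F integer_group) a D"
proof -
  let ?H = "wreath_product F integer_group"
  interpret F: group F by (rule F)
  interpret H: group ?H by (rule group_wreath_product[OF F group_integer_group])
  have DH: "D \<subseteq> carrier ?H"
    using a by (auto simp: D_def carrier_wreath_product[OF F] PiE_iff)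
  have ne: "(\<lambda>_. \<one>\<^bsub>F\<^esub>, 1) \<noteq> ((\<lambda>_. \<one>\<^bsub>F\<^esub>)(0 := a), 1)"
    using a by (metis fun_upd_same prod.inject)
  let ?endpoint = "\<lambda>w. foldr (\<otimes>\<^bsub>?H\<^esub>) w \<one>\<^bsub>?H\<^esub>"
  have fst_endpoint: "fst (?endpoint (d # w)) i = fst d i \<otimes>\<^bsub>F\<^esub> fst (?endpoint w) (i - 1)" if "d \<in> D" for d w i
    using that by (cases "?endpoint w") (auto simp: D_def mult_wreath_product)
  have negative: "fst (?endpoint w) i = \<one>\<^bsub>F\<^esub>" if "set w \<subseteq> D" "i < 0" for w i
    using that
  proof (induction w arbitrary: i)
    case Nil
    show ?case by (simp add: one_wreath_product)
  next
    case (Cons d w)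
    then have "fst (?endpoint w) (i - 1) = \<one>\<^bsub>F\<^esub>" "fst d i = \<one>\<^bsub>F\<^esub>"
      by (auto simp: D_def)
    then show ?case
      using fst_endpoint[of d w i] Cons.prems by simp
  qed
  have injective: "v = w"
    if "length v = length w" "set v \<subseteq> D" "set w \<subseteq> D" "?endpoint v = ?endpoint w" for v w
    using that
  proof (induction v w rule: list_induct2)
    case (Cons d v d' w)
    \<comment> \<open>The letters after the first are shifted by 1, so the lamp at 0 sees their
      product at position -1, where \<open>negative\<close> gives the unit.\<close>
    have first: "fst (?endpoint (b # x)) 0 = fst b 0" if "b \<in> D" "set x \<subseteq> D" for b x
      using that a by (subst fst_endpoint) (auto simp: negative D_def)
    then have "fst d 0 = fst d' 0"
      using Cons.prems first[of d v] first[of d' w]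
      by (metis list.set_intros(1) set_subset_Cons subset_trans subsetD)
    then have "d = d'"
      using Cons.prems a by (auto simp: D_def)
    moreover have "?endpoint v = ?endpoint w"
    proof -
      have "?endpoint v \<in> carrier ?H" "?endpoint w \<in> carrier ?H" "d \<in> carrier ?H"
        using Cons.prems DH by (auto intro!: H.foldr_mult_closed)
      moreover have "d \<otimes>\<^bsub>?H\<^esub> ?endpoint v = d \<otimes>\<^bsub>?H\<^esub> ?endpoint w"
        using Cons.prems(3) unfolding \<open>d = d'\<close> foldr_Cons o_apply .
      ultimately show ?thesis
        using H.l_cancel by blast
    qed
    ultimately show ?case
      using Cons by simp
  qed simp
  show ?thesis
  proof
    show "card D = 2"
      unfolding D_def card_2_iff using ne by blast
    show "inj_on ?endpoint {w. set w \<subseteq> D \<and> length w = n}" for n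
      by (rule inj_onI) (simp add: injective)
  qed (use a DH in auto)
qed

theorem corollary5p2:
  fixes F :: "('a, 'm) monoid_scheme"
    and \<Gamma> :: "((((int \<Rightarrow> 'a) \<times> int) \<Rightarrow> 'a) \<times> ((int \<Rightarrow> 'a) \<times> int)) monoid"
    and S :: "((((int \<Rightarrow> 'a) \<times> int) \<Rightarrow> 'a) \<times> ((int \<Rightarrow> 'a) \<times> int)) set"
    and f :: "real \<Rightarrow> real"
  assumes "group F" and "finite (carrier F)" and "carrier F \<noteq> {\<one>\<^bsub>F\<^esub>}"
    and "\<Gamma> = wreath_product F (wreath_product F integer_group)"
    and "finite_symmetric_generating_set \<Gamma> S"
    and "f = (\<lambda>t. 1 + ln (1 + t))"
  shows "fundamental_class \<Gamma> S f = \<one>\<^bsub>growth_homology_group \<Gamma> S f 0\<^esub>"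
proof -
  interpret F: group F by fact
  obtain a where "a \<in> carrier F" "a \<noteq> \<one>\<^bsub>F\<^esub>"
    using assms(3) F.one_closed by blast
  then show ?thesis
    using free_semigroup_wreath.fundamental_class_log_eq_one[OF
        lamplighter_free_semigroup[OF \<open>group F\<close>]] assms(4-6)
    by simp
qed

end
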